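(* Let $3\leq t\leq 6$, let $G$ be a planar graph with maximum degree $\Delta\geq 31-t$, and let $H$ be a subgraph of $G$ with maximum degree at most one. Then any total-$(\Delta+t)$-coloring of $H$ in $G$ can be extended to a total-$(\Delta+t)$-coloring of $G$.
   Context: All graphs are simple. A total-$k$-coloring of a graph is an assignment of colors from $\{1,\dots,k\}$ to its vertices and edges such that adjacent vertices receive different colors, edges sharing an endpoint receive different colors, and no edge receives the same color as either of its endpoints. For a subgraph $H$ of $G$, a total-$k$-coloring $\varphi$ of $H$ is a total-$k$-coloring of $H$ in $G$ if, in addition, $\varphi(u)\neq\varphi(v)$ for all $u,v\in V(H)$ adjacent in $G$. Extending $\varphi$ to $G$ means finding a total-$k$-coloring of $G$ that agrees with $\varphi$ on all vertices and edges of $H$. *)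

theory Defs
  imports "HOL-Analysis.Analysis"
begin

definition simple_graph :: "'a set \<Rightarrow> 'a set set \<Rightarrow> bool" where
  "simple_graph V E \<longleftrightarrow> finite V \<and> (\<forall>e\<in>E. e \<subseteq> V \<and> card e = 2)"

definition degree :: "'a set set \<Rightarrow> 'a \<Rightarrow> nat" where
  "degree E v = card {e\<in>E. v \<in> e}"

definition max_degree :: "'a set \<Rightarrow> 'a set set \<Rightarrow> nat" where
  "max_degree V E = Max (insert 0 (degree E ` V))"

definition subgraph :: "'a set \<Rightarrow> 'a set set \<Rightarrow> 'a set \<Rightarrow> 'a set set \<Rightarrow> bool" where
  "subgraph VH EH V E \<longleftrightarrow> VH \<subseteq> V \<and> EH \<subseteq> E \<and> (\<forall>e\<in>EH. e \<subseteq> VH)"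

definition planar :: "'a set \<Rightarrow> 'a set set \<Rightarrow> bool" where
  "planar V E \<longleftrightarrow> (\<exists>(p :: 'a \<Rightarrow> complex) (g :: 'a set \<Rightarrow> real \<Rightarrow> complex).
      inj_on p V \<and>
      (\<forall>e\<in>E. arc (g e) \<and> {pathstart (g e), pathfinish (g e)} = p ` e
              \<and> path_image (g e) \<inter> p ` V = p ` e) \<and>
      (\<forall>e\<in>E. \<forall>e'\<in>E. e \<noteq> e' \<longrightarrow> path_image (g e) \<inter> path_image (g e') \<subseteq> p ` (e \<inter> e')))"

definition total_coloring_in ::
  "'a set \<Rightarrow> 'a set set \<Rightarrow> 'a set \<Rightarrow> 'a set set \<Rightarrow> nat \<Rightarrow> ('a \<Rightarrow> nat) \<Rightarrow> ('a set \<Rightarrow> nat) \<Rightarrow> bool" where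
  "total_coloring_in VH EH V E k cv ce \<longleftrightarrow>
     (\<forall>v\<in>VH. cv v \<in> {1..k}) \<and> (\<forall>e\<in>EH. ce e \<in> {1..k}) \<and>
     (\<forall>u\<in>VH. \<forall>v\<in>VH. {u, v} \<in> E \<longrightarrow> cv u \<noteq> cv v) \<and>
     (\<forall>e\<in>EH. \<forall>e'\<in>EH. e \<noteq> e' \<and> e \<inter> e' \<noteq> {} \<longrightarrow> ce e \<noteq> ce e') \<and>
     (\<forall>e\<in>EH. \<forall>v\<in>e. ce e \<noteq> cv v)"

definition total_coloring ::
  "'a set \<Rightarrow> 'a set set \<Rightarrow> nat \<Rightarrow> ('a \<Rightarrow> nat) \<Rightarrow> ('a set \<Rightarrow> nat) \<Rightarrow> bool" where
  "total_coloring V E k cv ce \<longleftrightarrow> total_coloring_in V E V E k cv ce"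

end

theory Submission
  imports Defs
begin

text \<open>Colour the remaining vertices greedily and give every uncoloured edge the list of colours that
  are still admissible. Put \<open>N = \<Delta> + t - 2\<close>. With \<open>m v = 1\<close> at the vertices matched by \<open>H\<close> and
  \<open>m v = 0\<close> elsewhere, an edge \<open>uv\<close> keeps at least \<open>N - m u - m v\<close> colours, while at most
  \<open>N - 1 - m v\<close> uncoloured edges meet \<open>v\<close>. In a minimal counterexample to list colourability every
  edge has degree sum at least \<open>N\<close>. For \<open>k < 5\<close> the vertices of degree at most \<open>k + 1\<close>
  can be assigned to neighbours so that no vertex gets more than \<open>k\<close> of them: a failing augmenting
  path search exposes a bipartite subgraph whose edges can be coloured last by Galvin's kernel method.
  Discharging along these assignments gives \<open>|E| \<ge> 3|V|\<close>.

  Against this stands \<open>|E| \<le> 3|V| - 6\<close>, obtained without faces: drawings in which edges with a common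
  end may cross are closed under contraction, and a graph with \<open>3|V| - 5\<close> edges that is minimal under
  contraction has three common neighbours for every edge, hence a \<open>K\<^sub>5\<close> minor at a vertex
  of degree at most 5. That \<open>K\<^sub>5\<close> has no such drawing is a parity argument with continuous logarithms.\<close>

section \<open>Nonplanarity of the complete graph on five vertices\<close>

text \<open>The increment over the unit interval of a continuous logarithm of \<open>h\<close>. Its
  imaginary part is the change of argument, so this is a winding number that also makes sense for
  curves that do not close.\<close>

definition log_change :: "(real \<Rightarrow> complex) \<Rightarrow> complex \<Rightarrow> bool" where
  "log_change h z \<longleftrightarrow> (\<exists>g. continuous_on {0..1} g \<and> (\<forall>s\<in>{0..1}. h s = exp (g s)) \<and> z = g 1 - g 0)"

lemma log_change_exists:
  assumes "continuous_on {0..1} h" "\<And>s. s \<in> {0..1} \<Longrightarrow> h s \<noteq> 0"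
  shows "\<exists>z. log_change h z"
proof -
  have "contractible {0..1::real}"
    by (rule convex_imp_contractible) simp
  then obtain g where "continuous_on {0..1} g" "\<And>s. s \<in> {0..1} \<Longrightarrow> h s = exp (g s)"
    using continuous_logarithm_on_contractible[OF assms(1) _ assms(2)] by metis
  then show ?thesis
    unfolding log_change_def by blast
qed

lemma log_change_exp:
  assumes "log_change h z"
  shows "exp z = h 1 / h 0"
proof -
  obtain g where g: "\<forall>s\<in>{0..1}. h s = exp (g s)" "z = g 1 - g 0"
    using assms unfolding log_change_def by blast
  then show ?thesis
    by (simp add: exp_diff)
qed

text \<open>The difference of the two logarithms is continuous and takes its values among the
  logarithms of \<open>c\<close>, a set with gaps of 2 pi, so it is constant and cancels in the
  increments. The factor \<open>c\<close> allows \<open>e - f\<close> to be compared with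
  \<open>f - e\<close>.\<close>

lemma log_change_unique:
  assumes "log_change h z" "log_change h' z'"
    and c: "\<And>s. s \<in> {0..1} \<Longrightarrow> h' s = c * h s"
  shows "z' = z"
proof -
  obtain g where g: "continuous_on {0..1} g" "\<And>s. s \<in> {0..1} \<Longrightarrow> h s = exp (g s)" "z = g 1 - g 0"
    using assms unfolding log_change_def by blast
  obtain g' where g': "continuous_on {0..1} g'" "\<And>s. s \<in> {0..1} \<Longrightarrow> h' s = exp (g' s)" "z' = g' 1 - g' 0"
    using assms unfolding log_change_def by blast
  have e: "exp (g' s - g s) = c" if "s \<in> {0..1}" for s
    using c[OF that] g(2)[OF that] g'(2)[OF that] by (simp add: exp_diff)
  have "(\<lambda>s. g' s - g s) constant_on {0..1}"
  proof (rule continuous_discrete_range_constant)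
    show "continuous_on {0..1} (\<lambda>s. g' s - g s)"
      using g g' by (intro continuous_intros)
    fix x :: real assume x: "x \<in> {0..1}"
    have "2*pi \<le> norm (g' y - g y - (g' x - g x))"
      if y: "y \<in> {0..1}" and ne: "g' y - g y \<noteq> g' x - g x" for y
    proof -
      have "exp (g' y - g y) = exp (g' x - g x)"
        using e x y by simp
      then obtain n :: int where n: "g' y - g y = (g' x - g x) + (of_int (2 * n) * pi) * \<i>"
        by (metis exp_eq)
      then have n0: "n \<noteq> 0" using ne by auto
      have "norm (g' y - g y - (g' x - g x)) = 2 * \<bar>real_of_int n\<bar> * pi"
        unfolding n by (simp add: norm_mult abs_mult)
      moreover have "\<bar>real_of_int n\<bar> \<ge> 1" using n0 by linarith
      ultimately show ?thesis by simp
    qed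
    then show "\<exists>e>0. \<forall>y. y \<in> {0..1} \<and> g' y - g y \<noteq> g' x - g x \<longrightarrow> e \<le> norm (g' y - g y - (g' x - g x))"
      by (intro exI[of _ "2*pi"]) auto
  qed simp
  then obtain k where "\<And>s. s \<in> {0..1} \<Longrightarrow> g' s - g s = k"
    unfolding constant_on_def by metis
  from this[of 0] this[of 1] show ?thesis
    unfolding g(3) g'(3) by (simp add: algebra_simps)
qed

text \<open>Disjointness makes \<open>e s - f t\<close> nonzero on the unit square, which is
  contractible and so carries a continuous logarithm \<open>G\<close>. Both sides equal
  \<open>G (1,1) - G (0,0)\<close>, read along the two ways round the boundary.\<close>

lemma log_change_square:
  assumes "path e" "path f" and disj: "path_image e \<inter> path_image f = {}"
    and x0: "log_change (\<lambda>s. e s - pathstart f) x0"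
    and x1: "log_change (\<lambda>s. e s - pathfinish f) x1"
    and y0: "log_change (\<lambda>s. f s - pathstart e) y0"
    and y1: "log_change (\<lambda>s. f s - pathfinish e) y1"
  shows "x0 + y1 = x1 + y0"
proof -
  let ?S = "{0..1::real} \<times> {0..1::real}"
  have ce: "continuous_on {0..1} e" and cf: "continuous_on {0..1} f"
    using assms unfolding path_def by auto
  have "continuous_on ?S (\<lambda>x. e (fst x))"
    by (rule continuous_on_compose2[OF ce]) (auto intro: continuous_intros)
  moreover have "continuous_on ?S (\<lambda>x. f (snd x))"
    by (rule continuous_on_compose2[OF cf]) (auto intro: continuous_intros)
  ultimately have cont: "continuous_on ?S (\<lambda>x. e (fst x) - f (snd x))"
    by (intro continuous_intros)
  have contr: "contractible ?S"
    by (intro convex_imp_contractible convex_Times) simp_all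
  have nz: "\<And>x. x \<in> ?S \<Longrightarrow> e (fst x) - f (snd x) \<noteq> 0"
    using disj unfolding path_image_def by fastforce
  obtain G where G: "continuous_on ?S G" "\<And>x. x \<in> ?S \<Longrightarrow> e (fst x) - f (snd x) = exp (G x)"
    using continuous_logarithm_on_contractible[OF cont contr nz] by metis
  have h: "log_change (\<lambda>s. e s - f t) (G (1,t) - G (0,t))" if "t \<in> {0..1}" for t
    unfolding log_change_def
  proof (intro exI[of _ "\<lambda>s. G (s,t)"] conjI ballI)
    show "continuous_on {0..1} (\<lambda>s. G (s,t))"
      by (rule continuous_on_compose2[OF G(1)]) (use that in \<open>auto intro: continuous_intros\<close>)
    show "e s - f t = exp (G (s,t))" if "s \<in> {0..1}" for s
      using G(2)[of "(s,t)"] that \<open>t \<in> {0..1}\<close> by simp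
  qed simp
  have v: "log_change (\<lambda>t. e s - f t) (G (s,1) - G (s,0))" if "s \<in> {0..1}" for s
    unfolding log_change_def
  proof (intro exI[of _ "\<lambda>t. G (s,t)"] conjI ballI)
    show "continuous_on {0..1} (\<lambda>t. G (s,t))"
      by (rule continuous_on_compose2[OF G(1)]) (use that in \<open>auto intro: continuous_intros\<close>)
    show "e s - f t = exp (G (s,t))" if "t \<in> {0..1}" for t
      using G(2)[of "(s,t)"] that \<open>s \<in> {0..1}\<close> by simp
  qed simp
  have "x0 = G (1,0) - G (0,0)"
    by (rule log_change_unique[OF h[of 0] x0, of 1]) (auto simp: pathstart_def)
  moreover have "x1 = G (1,1) - G (0,1)"
    by (rule log_change_unique[OF h[of 1] x1, of 1]) (auto simp: pathfinish_def)
  \<comment> \<open>\<open>y0\<close> and \<open>y1\<close> refer to \<open>f - e\<close>, whence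
    the factor -1.\<close>
  moreover have "y0 = G (0,1) - G (0,0)"
    by (rule log_change_unique[OF v[of 0] y0, of "-1"]) (auto simp: pathstart_def)
  moreover have "y1 = G (1,1) - G (1,0)"
    by (rule log_change_unique[OF v[of 1] y1, of "-1"]) (auto simp: pathfinish_def)
  ultimately show ?thesis by simp
qed

lemma no_K5_paths:
  fixes q :: "nat \<Rightarrow> complex" and g :: "nat \<Rightarrow> nat \<Rightarrow> real \<Rightarrow> complex"
  assumes g: "\<And>a b. a < b \<Longrightarrow> b < 5 \<Longrightarrow> path (g a b) \<and> pathstart (g a b) = q a \<and> pathfinish (g a b) = q b"
    and avoid: "\<And>a b c. a < b \<Longrightarrow> b < 5 \<Longrightarrow> c < 5 \<Longrightarrow> c \<noteq> a \<Longrightarrow> c \<noteq> b \<Longrightarrow> q c \<notin> path_image (g a b)"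
    and disj: "\<And>a b c d. a < b \<Longrightarrow> b < 5 \<Longrightarrow> c < d \<Longrightarrow> d < 5 \<Longrightarrow> {a,b} \<inter> {c,d} = {} \<Longrightarrow>
                 path_image (g a b) \<inter> path_image (g c d) = {}"
  shows False
proof -
  have q: "q x \<noteq> q y" if "x < 5" "y < 5" "x \<noteq> y" for x y
  proof -
    \<comment> \<open>The edge from \<open>x\<close> to a third vertex \<open>z\<close> contains
      \<open>q x\<close> but avoids \<open>q y\<close>.\<close>
    have "\<exists>z<5::nat. z \<noteq> x \<and> z \<noteq> y" by presburger
    then obtain z :: nat where "z < 5" "z \<noteq> x" "z \<noteq> y" by blast
    then show ?thesis
      using avoid[of "min x z" "max x z" y] g[of "min x z" "max x z"] that
        pathstart_in_path_image[of "g (min x z) (max x z)"] pathfinish_in_path_image[of "g (min x z) (max x z)"]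
      by (auto simp: min_def max_def split: if_splits)
  qed
  \<comment> \<open>\<open>Lg x y\<close> is a logarithm of \<open>q x - q y\<close>. Measured against it, the winding of edge \<open>ab\<close> about \<open>c\<close> is
    an integer \<open>n a b c\<close>. For disjoint edges \<open>ab\<close>, \<open>cd\<close> the sum of the four integers involved is odd iff
    the two chords cross in a convex pentagon. Over all 15 pairs every integer occurs twice, but
    a convex pentagon has 5 crossings.\<close>
  define \<epsilon> :: "nat \<Rightarrow> nat \<Rightarrow> int" where "\<epsilon> = (\<lambda>x y. if x < y then 1 else - 1)"
  define Lg where "Lg = (\<lambda>x y. Ln (q (max x y) - q (min x y)) + (if x < y then \<i> * pi else 0))"
  have exp_Lg: "exp (Lg x y) = q x - q y" if "x < 5" "y < 5" "x \<noteq> y" for x y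
    using q[OF that] by (auto simp: Lg_def exp_add max_def min_def)
  have Lg_swap: "Lg x y - Lg y x = of_int (\<epsilon> x y) * (\<i> * pi)" if "x \<noteq> y" for x y
    using that by (auto simp: Lg_def \<epsilon>_def max.commute min.commute)
  have "\<exists>n::int. log_change (\<lambda>s. g a b s - q c) (Lg b c - Lg a c + 2 * of_int n * (\<i> * pi))"
    if h: "a < b" "b < 5" "c < 5" "c \<noteq> a" "c \<noteq> b" for a b c
  proof -
    have "continuous_on {0..1} (\<lambda>s. g a b s - q c)"
      using g[OF h(1,2)] unfolding path_def by (intro continuous_intros) auto
    moreover have "g a b s - q c \<noteq> 0" if "s \<in> {0..1}" for s
      using avoid[OF h] that unfolding path_image_def by (metis eq_iff_diff_eq_0 image_eqI)
    ultimately obtain z where z: "log_change (\<lambda>s. g a b s - q c) z"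
      using log_change_exists by meson
    have "exp z = (q b - q c) / (q a - q c)"
      using log_change_exp[OF z] g[OF h(1,2)] by (simp add: pathstart_def pathfinish_def)
    also have "\<dots> = exp (Lg b c - Lg a c)"
      using h by (simp add: exp_diff exp_Lg)
    finally obtain n :: int where "z = Lg b c - Lg a c + (of_int (2 * n) * pi) * \<i>"
      by (metis exp_eq)
    then show ?thesis using z by (auto simp: mult_ac intro!: exI[of _ n])
  qed
  then obtain n :: "nat \<Rightarrow> nat \<Rightarrow> nat \<Rightarrow> int"
    where n: "\<And>a b c. a < b \<Longrightarrow> b < 5 \<Longrightarrow> c < 5 \<Longrightarrow> c \<noteq> a \<Longrightarrow> c \<noteq> b \<Longrightarrow>
      log_change (\<lambda>s. g a b s - q c) (Lg b c - Lg a c + 2 * of_int (n a b c) * (\<i> * pi))"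
    by metis
  have key: "\<epsilon> b c + \<epsilon> d b + \<epsilon> a d + \<epsilon> c a + 2 * (n a b c + n c d b - n a b d - n c d a) = 0"
    if h: "a < b" "b < 5" "c < d" "d < 5" "a \<noteq> c" "a \<noteq> d" "b \<noteq> c" "b \<noteq> d" for a b c d
  proof -
    let ?k = "\<i> * complex_of_real pi"
    have sq: "Lg b c - Lg a c + 2 * of_int (n a b c) * ?k + (Lg d b - Lg c b + 2 * of_int (n c d b) * ?k)
       = Lg b d - Lg a d + 2 * of_int (n a b d) * ?k + (Lg d a - Lg c a + 2 * of_int (n c d a) * ?k)"
    proof (rule log_change_square[of "g a b" "g c d"])
      show "path (g a b)" "path (g c d)" "path_image (g a b) \<inter> path_image (g c d) = {}"
        using h g disj[of a b c d] by auto
      have e: "pathstart (g a b) = q a" "pathfinish (g a b) = q b" "pathstart (g c d) = q c" "pathfinish (g c d) = q d"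
        using h g by auto
      show "log_change (\<lambda>s. g a b s - pathstart (g c d)) (Lg b c - Lg a c + 2 * of_int (n a b c) * ?k)"
        unfolding e using h by (intro n) auto
      show "log_change (\<lambda>s. g a b s - pathfinish (g c d)) (Lg b d - Lg a d + 2 * of_int (n a b d) * ?k)"
        unfolding e using h by (intro n) auto
      show "log_change (\<lambda>s. g c d s - pathstart (g a b)) (Lg d a - Lg c a + 2 * of_int (n c d a) * ?k)"
        unfolding e using h by (intro n) auto
      show "log_change (\<lambda>s. g c d s - pathfinish (g a b)) (Lg d b - Lg c b + 2 * of_int (n c d b) * ?k)"
        unfolding e using h by (intro n) auto
    qed
    have sw: "Lg b c - Lg c b = of_int (\<epsilon> b c) * ?k" "Lg d b - Lg b d = of_int (\<epsilon> d b) * ?k"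
      "Lg a d - Lg d a = of_int (\<epsilon> a d) * ?k" "Lg c a - Lg a c = of_int (\<epsilon> c a) * ?k"
      using h Lg_swap by auto
    \<comment> \<open>The values \<open>Lg\<close> occur in pairs with swapped arguments; replacing
      each pair by its sign leaves an integer multiple of \<open>?k\<close>.\<close>
    have "(of_int (\<epsilon> b c) + of_int (\<epsilon> d b) + of_int (\<epsilon> a d) + of_int (\<epsilon> c a) +
        2 * (of_int (n a b c) + of_int (n c d b) - of_int (n a b d) - of_int (n c d a))) * ?k = 0"
      using sq sw by algebra
    then have "of_int (\<epsilon> b c) + of_int (\<epsilon> d b) + of_int (\<epsilon> a d) + of_int (\<epsilon> c a) +
        2 * (of_int (n a b c) + of_int (n c d b) - of_int (n a b d) - of_int (n c d a)) = (0::complex)"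
      by simp
    then have "of_int (\<epsilon> b c + \<epsilon> d b + \<epsilon> a d + \<epsilon> c a + 2 * (n a b c + n c d b - n a b d - n c d a)) = (0::complex)"
      by (simp only: of_int_add of_int_diff of_int_mult of_int_numeral)
    then show ?thesis by (simp only: of_int_eq_0_iff)
  qed
  \<comment> \<open>The pairs of disjoint edges: five choices of the vertex left out, three
    matchings of the other four.\<close>
  note * = key[of 0 1 2 3] key[of 0 1 2 4] key[of 0 1 3 4] key[of 0 2 1 3] key[of 0 2 1 4] key[of 0 2 3 4]
    key[of 0 3 1 2] key[of 0 3 1 4] key[of 0 3 2 4] key[of 0 4 1 2] key[of 0 4 1 3] key[of 0 4 2 3]
    key[of 1 2 3 4] key[of 1 3 2 4] key[of 1 4 2 3]
  note ** = *[unfolded \<epsilon>_def, simplified]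
  \<comment> \<open>In the sum of the 15 identities the signs contribute -2 for each of the five
    crossing pairs and 0 for the others. Of the thirty integers, ten cancel and twenty get
    coefficient 4 or -4. Halving gives an even number equal to 5.\<close>
  have "2 * (n 0 1 2 + n 0 2 1 + n 1 3 2 + n 1 4 2 + n 3 4 2 + n 0 3 1 + n 1 2 3 + n 2 4 3 + n 0 4 1 + n 2 3 4 - n 2 3 0 - n 0 1 4 - n 2 4 0 - n 3 4 0 - n 1 3 0 - n 0 2 4 - n 1 4 0 - n 1 2 0 - n 0 3 4 - n 0 4 3) = (5::int)"
    using ** by simp
  then show False by presburger
qed

section \<open>Edge density\<close>

text \<open>Edges with a common end may intersect arbitrarily, and an edge need only be path-connected:
  this makes contraction a mere union of two sets.\<close>
definition drawable :: "'a set \<Rightarrow> 'a set set \<Rightarrow> bool" where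
  "drawable V E \<longleftrightarrow> (\<exists>(p :: 'a \<Rightarrow> complex) P.
      (\<forall>e\<in>E. path_connected (P e) \<and> p ` e \<subseteq> P e \<and> (\<forall>w\<in>V. w \<notin> e \<longrightarrow> p w \<notin> P e)) \<and>
      (\<forall>e\<in>E. \<forall>e'\<in>E. e \<inter> e' = {} \<longrightarrow> P e \<inter> P e' = {}))"

lemma drawableE:
  assumes "drawable V E"
  obtains p :: "'a \<Rightarrow> complex" and P where
    "\<And>e. e \<in> E \<Longrightarrow> path_connected (P e)"
    "\<And>e. e \<in> E \<Longrightarrow> p ` e \<subseteq> P e"
    "\<And>e w. e \<in> E \<Longrightarrow> w \<in> V \<Longrightarrow> w \<notin> e \<Longrightarrow> p w \<notin> P e"
    "\<And>e e'. e \<in> E \<Longrightarrow> e' \<in> E \<Longrightarrow> e \<inter> e' = {} \<Longrightarrow> P e \<inter> P e' = {}"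
proof -
  obtain p :: "'a \<Rightarrow> complex" and P where
    "\<forall>e\<in>E. path_connected (P e) \<and> p ` e \<subseteq> P e \<and> (\<forall>w\<in>V. w \<notin> e \<longrightarrow> p w \<notin> P e)"
    "\<forall>e\<in>E. \<forall>e'\<in>E. e \<inter> e' = {} \<longrightarrow> P e \<inter> P e' = {}"
    using assms unfolding drawable_def by (elim exE conjE)
  then show ?thesis by (intro that[of P p]) simp_all
qed

lemma planar_imp_drawable:
  assumes "simple_graph V E" "planar V E"
  shows "drawable V E"
proof -
  obtain p :: "'a \<Rightarrow> complex" and g where inj: "inj_on p V"
    and g: "\<And>e. e \<in> E \<Longrightarrow> arc (g e) \<and> path_image (g e) \<inter> p ` V = p ` e"
    and disj: "\<And>e e'. e \<in> E \<Longrightarrow> e' \<in> E \<Longrightarrow> e \<noteq> e' \<Longrightarrow> path_image (g e) \<inter> path_image (g e') \<subseteq> p ` (e \<inter> e')"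
    using assms(2) unfolding planar_def by metis
  show ?thesis
    unfolding drawable_def
  proof (intro exI[of _ p] exI[of _ "\<lambda>e. path_image (g e)"] conjI ballI impI)
    fix e assume e: "e \<in> E"
    show "path_connected (path_image (g e))"
      using g[OF e] by (simp add: arc_imp_path path_connected_path_image)
    show "p ` e \<subseteq> path_image (g e)"
      using g[OF e] by blast
    show "p w \<notin> path_image (g e)" if "w \<in> V" "w \<notin> e" for w
    proof
      assume "p w \<in> path_image (g e)"
      then have "p w \<in> p ` e" using g[OF e] that by blast
      moreover have "e \<subseteq> V" using assms(1) e unfolding simple_graph_def by blast
      ultimately show False using inj that unfolding inj_on_def by blast
    qed
    show "path_image (g e) \<inter> path_image (g e') = {}" if "e' \<in> E" "e \<inter> e' = {}" for e'
    \<comment> \<open>Disjoint edges are distinct, since an edge is not empty.\<close>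
    proof (cases "e = e'")
      case True
      then have "card e = 0" using that by simp
      then show ?thesis using assms(1) e unfolding simple_graph_def by fastforce
    qed (use disj[OF e that(1)] that in auto)
  qed
qed

lemma drawable_mono:
  assumes "drawable V E" "V' \<subseteq> V" "E' \<subseteq> E"
  shows "drawable V' E'"
proof -
  obtain p :: "'a \<Rightarrow> complex" and P where
    P: "\<forall>e\<in>E. path_connected (P e) \<and> p ` e \<subseteq> P e \<and> (\<forall>w\<in>V. w \<notin> e \<longrightarrow> p w \<notin> P e)"
    "\<forall>e\<in>E. \<forall>e'\<in>E. e \<inter> e' = {} \<longrightarrow> P e \<inter> P e' = {}"
    using assms(1) unfolding drawable_def by (elim exE conjE)
  show ?thesis
    unfolding drawable_def
  proof (intro exI[of _ p] exI[of _ P] conjI)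
    show "\<forall>e\<in>E'. path_connected (P e) \<and> p ` e \<subseteq> P e \<and> (\<forall>w\<in>V'. w \<notin> e \<longrightarrow> p w \<notin> P e)"
      using P(1) assms(2,3) by blast
    show "\<forall>e\<in>E'. \<forall>e'\<in>E'. e \<inter> e' = {} \<longrightarrow> P e \<inter> P e' = {}"
      using P(2) assms(3) by (metis subsetD)
  qed
qed

section \<open>Simple graphs and edge contraction\<close>

lemma simple_graph_mono:
  assumes "simple_graph V E" "E' \<subseteq> E"
  shows "simple_graph V E'"
  using assms unfolding simple_graph_def by blast

lemma simple_graph_finite:
  assumes "simple_graph V E"
  shows "finite E"
proof (rule finite_subset)
  show "E \<subseteq> Pow V" "finite (Pow V)" using assms unfolding simple_graph_def by auto
qed

lemma simple_graph_edgeD: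
  assumes "simple_graph V E" "{u, v} \<in> E"
  shows "u \<noteq> v" "u \<in> V" "v \<in> V"
  using assms unfolding simple_graph_def by fastforce+

lemma simple_graph_edgeE:
  assumes "simple_graph V E" "e \<in> E" "v \<in> e"
  obtains w where "e = {v, w}" "w \<noteq> v"
proof -
  have "card e = 2" using assms unfolding simple_graph_def by blast
  then obtain x y where "e = {x, y}" "x \<noteq> y" by (auto simp: card_2_iff)
  then show ?thesis using that[of x] that[of y] assms(3) by auto
qed

text \<open>\<open>v\<close> is merged into \<open>u\<close>. Working with sets identifies parallel
  edges, and the condition \<open>w \<noteq> u\<close> drops the loop.\<close>

definition contract_edges :: "'a set set \<Rightarrow> 'a \<Rightarrow> 'a \<Rightarrow> 'a set set" where
  "contract_edges E u v = {e\<in>E. v \<notin> e} \<union> {{u, w} |w. {v, w} \<in> E \<and> w \<noteq> u}"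

lemma contract_edges_simple:
  assumes "simple_graph V E" "{u, v} \<in> E"
  shows "simple_graph (V - {v}) (contract_edges E u v)"
  unfolding simple_graph_def contract_edges_def
proof (intro conjI ballI)
  show "finite (V - {v})" using assms unfolding simple_graph_def by blast
  fix e assume "e \<in> {e\<in>E. v \<notin> e} \<union> {{u, w} |w. {v, w} \<in> E \<and> w \<noteq> u}"
  then consider "e \<in> E" "v \<notin> e" | w where "e = {u, w}" "{v, w} \<in> E" "w \<noteq> u" by blast
  then have "e \<subseteq> V - {v} \<and> card e = 2"
  proof cases
    case 1
    then show ?thesis using assms unfolding simple_graph_def by blast
  next
    case 2
    then show ?thesis
      using simple_graph_edgeD[OF assms] simple_graph_edgeD[OF assms(1) 2(2)] by auto
  qed
  then show "e \<subseteq> V - {v}" "card e = 2" by auto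
qed

text \<open>All points stay where they are; a redirected edge \<open>{u, w}\<close> is drawn as the
  union of the old \<open>{u, v}\<close> and \<open>{v, w}\<close>, connected through
  \<open>p v\<close>. A surviving old edge misses \<open>v\<close>, so if it is disjoint from
  \<open>{u, w}\<close> it avoids both pieces. Two redirected edges share \<open>u\<close>.\<close>

lemma contract_edges_drawable:
  assumes G: "simple_graph V E" "{u, v} \<in> E" and "drawable V E"
  shows "drawable (V - {v}) (contract_edges E u v)"
proof -
  obtain p :: "'a \<Rightarrow> complex" and P where
    conn: "\<And>e. e \<in> E \<Longrightarrow> path_connected (P e)" and
    ends: "\<And>e. e \<in> E \<Longrightarrow> p ` e \<subseteq> P e" and
    avoid: "\<And>e w. e \<in> E \<Longrightarrow> w \<in> V \<Longrightarrow> w \<notin> e \<Longrightarrow> p w \<notin> P e" and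
    disj: "\<And>e e'. e \<in> E \<Longrightarrow> e' \<in> E \<Longrightarrow> e \<inter> e' = {} \<Longrightarrow> P e \<inter> P e' = {}"
    by (rule drawableE[OF assms(3)]) (rule that; assumption)
  \<comment> \<open>For \<open>e = {u, w}\<close> the set \<open>insert v (e - {u})\<close> is the
    old edge \<open>{v, w}\<close>. An edge that survives from \<open>E\<close> keeps its
    drawing.\<close>
  define P' where "P' = (\<lambda>e. if e \<in> E \<and> v \<notin> e then P e else P {u, v} \<union> P (insert v (e - {u})))"
  have new: "P' {u, w} = P {u, v} \<union> P {v, w}" if "{u, w} \<notin> E" "w \<noteq> u" for w
  proof -
    have "insert v ({u, w} - {u}) = {v, w}" using that by auto
    then show ?thesis using that by (simp add: P'_def)
  qed
  have cases: "(e \<in> E \<and> v \<notin> e \<and> P' e = P e) \<or>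
      (\<exists>w. e = {u, w} \<and> {v, w} \<in> E \<and> w \<noteq> u \<and> w \<noteq> v \<and> P' e = P {u, v} \<union> P {v, w})"
    if e: "e \<in> contract_edges E u v" for e
  proof (cases "e \<in> E \<and> v \<notin> e")
    case True
    then show ?thesis by (simp add: P'_def)
  next
    case False
    then obtain w where w: "e = {u, w}" "{v, w} \<in> E" "w \<noteq> u"
      using e unfolding contract_edges_def by blast
    have "w \<noteq> v" "u \<noteq> v" using simple_graph_edgeD[OF G] simple_graph_edgeD[OF G(1) w(2)] by auto
    then show ?thesis using w False new[of w] by auto
  qed
  have uv: "u \<noteq> v" using simple_graph_edgeD[OF G] by simp
  show ?thesis
    unfolding drawable_def
  proof (intro exI[of _ p] exI[of _ P'] conjI ballI impI)
    fix e assume e: "e \<in> contract_edges E u v"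
    show "path_connected (P' e)"
      using cases[OF e]
    proof (elim disjE exE conjE)
      fix w assume "P' e = P {u, v} \<union> P {v, w}" "{v, w} \<in> E"
      moreover have "p v \<in> P {u, v} \<inter> P {v, w}"
        using ends[OF G(2)] ends[OF \<open>{v, w} \<in> E\<close>] by auto
      ultimately show ?thesis
        using path_connected_Un[OF conn[OF G(2)] conn[OF \<open>{v, w} \<in> E\<close>]] by auto
    qed (use conn in auto)
    show "p ` e \<subseteq> P' e"
      using cases[OF e]
    proof (elim disjE exE conjE)
      fix w assume "P' e = P {u, v} \<union> P {v, w}" "{v, w} \<in> E" "e = {u, w}"
      then show ?thesis using ends[OF G(2)] ends[of "{v, w}"] by auto
    qed (use ends in auto)
    show "p x \<notin> P' e" if "x \<in> V - {v}" "x \<notin> e" for x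
      using cases[OF e]
    proof (elim disjE exE conjE)
      fix w assume "P' e = P {u, v} \<union> P {v, w}" "{v, w} \<in> E" "e = {u, w}"
      then show ?thesis using avoid[of "{u,v}" x] avoid[of "{v,w}" x] that G(2) by auto
    qed (use avoid that in auto)
    show "P' e \<inter> P' e' = {}" if e': "e' \<in> contract_edges E u v" and ee: "e \<inter> e' = {}" for e'
    proof -
      have *: "(P {u, v} \<union> P {v, w}) \<inter> P f = {}"
        if "{v, w} \<in> E" "f \<in> E" "v \<notin> f" "{u, w} \<inter> f = {}" for w f
        using disj[OF G(2) that(2)] disj[OF that(1,2)] that by blast
      show ?thesis
        using cases[OF e]
      proof (elim disjE exE conjE)
        assume A: "e \<in> E" "v \<notin> e" "P' e = P e"
        show ?thesis
          using cases[OF e']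
        proof (elim disjE exE conjE)
          fix w assume "e' = {u, w}" "{v, w} \<in> E" "P' e' = P {u, v} \<union> P {v, w}"
          then show ?thesis using *[of w e] A ee by blast
        qed (use disj[of e e'] A ee in auto)
      next
        fix w assume A: "e = {u, w}" "{v, w} \<in> E" "P' e = P {u, v} \<union> P {v, w}"
        show ?thesis
          using cases[OF e']
        proof (elim disjE exE conjE)
          assume "e' \<in> E" "v \<notin> e'" "P' e' = P e'"
          then show ?thesis using *[of w e'] A ee by blast
        qed (use A ee in auto)
      qed
    qed
  qed
qed

text \<open>Path-connectedness provides a path for each pair inside its set, a numbering of
  \<open>K\<close> orients the edges, and the separation properties pass to the paths.\<close>

lemma no_K5:
  assumes "drawable V E" "K \<subseteq> V" "card K = 5"
    and K: "\<And>x y. x \<in> K \<Longrightarrow> y \<in> K \<Longrightarrow> x \<noteq> y \<Longrightarrow> {x, y} \<in> E"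
  shows False
proof -
  obtain p :: "'a \<Rightarrow> complex" and P where
    conn: "\<And>e. e \<in> E \<Longrightarrow> path_connected (P e)" and
    ends: "\<And>e. e \<in> E \<Longrightarrow> p ` e \<subseteq> P e" and
    avoid: "\<And>e w. e \<in> E \<Longrightarrow> w \<in> V \<Longrightarrow> w \<notin> e \<Longrightarrow> p w \<notin> P e" and
    disj: "\<And>e e'. e \<in> E \<Longrightarrow> e' \<in> E \<Longrightarrow> e \<inter> e' = {} \<Longrightarrow> P e \<inter> P e' = {}"
    by (rule drawableE[OF assms(1)]) (rule that; assumption)
  have "finite K" using assms(3) card.infinite by fastforce
  then obtain h :: "nat \<Rightarrow> 'a" where h: "bij_betw h {..<5} K"
    using ex_bij_betw_nat_finite assms(3) by (metis atLeast0LessThan)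
  have hK: "h i \<in> K" if "i < 5" for i using h that unfolding bij_betw_def by auto
  have hinj: "h i = h j \<longleftrightarrow> i = j" if "i < 5" "j < 5" for i j
    using h that unfolding bij_betw_def inj_on_def by auto
  have hE: "{h i, h j} \<in> E" if "i < j" "j < 5" for i j
    using K hK hinj that by (metis less_trans less_irrefl)
  have "\<exists>g. path g \<and> path_image g \<subseteq> P {h i, h j} \<and> pathstart g = p (h i) \<and> pathfinish g = p (h j)"
    if "i < j" "j < 5" for i j
    using conn[OF hE[OF that]] ends[OF hE[OF that]] unfolding path_connected_def by auto
  then obtain g where g: "\<And>i j. i < j \<Longrightarrow> j < 5 \<Longrightarrow> path (g i j) \<and> path_image (g i j) \<subseteq> P {h i, h j} \<and>
      pathstart (g i j) = p (h i) \<and> pathfinish (g i j) = p (h j)"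
    by metis
  show False
  proof (rule no_K5_paths[of g "\<lambda>i. p (h i)"])
    fix a b :: nat assume ab: "a < b" "b < 5"
    show "path (g a b) \<and> pathstart (g a b) = p (h a) \<and> pathfinish (g a b) = p (h b)"
      using g[OF ab] by blast
    show "p (h c) \<notin> path_image (g a b)" if "c < 5" "c \<noteq> a" "c \<noteq> b" for c
      using g[OF ab] avoid[OF hE[OF ab], of "h c"] hK[of c] assms(2) hinj[of c a] hinj[of c b] ab that by auto
    show "path_image (g a b) \<inter> path_image (g c d) = {}" if cd: "c < d" "d < 5" "{a, b} \<inter> {c, d} = {}" for c d
    proof -
      have "{h a, h b} \<inter> {h c, h d} = {}" using ab cd by (auto simp: hinj)
      then show ?thesis using g[OF ab] g[OF cd(1,2)] disj[OF hE[OF ab] hE[OF cd(1,2)]] by blast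
    qed
  qed
qed

section \<open>Neighbourhoods and edge counts\<close>

definition nbrs :: "'a set set \<Rightarrow> 'a \<Rightarrow> 'a set" where
  "nbrs E v = {w. {v, w} \<in> E}"

lemma nbrs_subset: "simple_graph V E \<Longrightarrow> nbrs E v \<subseteq> V - {v}"
  unfolding nbrs_def by (auto dest: simple_graph_edgeD)

lemma finite_nbrs: "simple_graph V E \<Longrightarrow> finite (nbrs E v)"
  by (rule finite_subset[OF nbrs_subset]) (auto simp: simple_graph_def)

lemma degree_eq_card_nbrs:
  assumes "simple_graph V E"
  shows "degree E v = card (nbrs E v)"
proof -
  have "bij_betw (\<lambda>w. {v, w}) (nbrs E v) {e\<in>E. v \<in> e}"
    unfolding bij_betw_def
  proof
    show "inj_on (\<lambda>w. {v, w}) (nbrs E v)"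
      by (auto simp: inj_on_def doubleton_eq_iff)
    show "(\<lambda>w. {v, w}) ` nbrs E v = {e\<in>E. v \<in> e}"
    proof
      show "{e\<in>E. v \<in> e} \<subseteq> (\<lambda>w. {v, w}) ` nbrs E v"
      proof
        fix e assume e: "e \<in> {e\<in>E. v \<in> e}"
        then obtain w where "e = {v, w}" using simple_graph_edgeE[OF assms] by blast
        then show "e \<in> (\<lambda>w. {v, w}) ` nbrs E v" using e unfolding nbrs_def by blast
      qed
    qed (auto simp: nbrs_def)
  qed
  then show ?thesis
    unfolding degree_def by (metis bij_betw_same_card)
qed

text \<open>Handshake count of incidences. \<open>U\<close> is left free because it serves both for
  \<open>V\<close> and for the set of covered vertices.\<close>

lemma sum_degree:
  assumes "simple_graph V E" "\<Union>E \<subseteq> U" "finite U"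
  shows "(\<Sum>v\<in>U. degree E v) = 2 * card E"
proof -
  have "(\<Sum>v\<in>U. degree E v) = (\<Sum>v\<in>U. \<Sum>e\<in>E. if v \<in> e then 1 else 0)"
    using simple_graph_finite[OF assms(1)] by (simp add: degree_def sum.If_cases Int_def)
  also have "\<dots> = (\<Sum>e\<in>E. \<Sum>v\<in>U. if v \<in> e then 1 else 0)"
    by (rule sum.swap)
  also have "\<dots> = (\<Sum>e\<in>E. 2)"
  proof (rule sum.cong)
    fix e assume e: "e \<in> E"
    have "{v \<in> U. v \<in> e} = e" using assms(2) e by blast
    moreover have "card e = 2" using e assms(1) unfolding simple_graph_def by blast
    ultimately show "(\<Sum>v\<in>U. if v \<in> e then 1 else 0) = (2::nat)"
      using assms(3) by (simp add: sum.If_cases Int_def)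
  qed simp
  finally show ?thesis by simp
qed

text \<open>Contraction destroys the edge \<open>{u, v}\<close>, and each common neighbour turns two
  edges into one. The set \<open>?R\<close> holds the neighbours of \<open>v\<close> whose edge is
  really moved.\<close>

lemma card_contract_edges:
  assumes "simple_graph V E" "{u, v} \<in> E"
  shows "card E = card (contract_edges E u v) + card (nbrs E u \<inter> nbrs E v) + 1"
proof -
  have fin: "finite E" using simple_graph_finite[OF assms(1)] .
  have finN: "finite (nbrs E v)"
    by (rule finite_nbrs[OF assms(1)])
  let ?R = "nbrs E v - (nbrs E u \<inter> nbrs E v) - {u}"
  have uv: "u \<noteq> v" using simple_graph_edgeD[OF assms] by simp
  have uN: "u \<in> nbrs E v" "u \<notin> nbrs E u"
    using assms simple_graph_edgeD[OF assms(1), of u u] by (auto simp: nbrs_def insert_commute)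
  have "contract_edges E u v = {e\<in>E. v \<notin> e} \<union> (\<lambda>w. {u, w}) ` ?R"
  proof -
    have "{u, w} \<in> E \<and> v \<notin> {u, w}" if "{v, w} \<in> E" "w \<in> nbrs E u" for w
      using that uv simple_graph_edgeD[OF assms(1) that(1)] by (simp add: nbrs_def)
    then show ?thesis
      unfolding contract_edges_def by (fastforce simp: nbrs_def)
  qed
  moreover have "card ({e\<in>E. v \<notin> e} \<union> (\<lambda>w. {u, w}) ` ?R) = card {e\<in>E. v \<notin> e} + card ((\<lambda>w. {u, w}) ` ?R)"
    using fin finN by (intro card_Un_disjoint) (auto simp: nbrs_def)
  moreover have "card ((\<lambda>w. {u, w}) ` ?R) = card ?R"
    by (rule card_image) (auto simp: inj_on_def doubleton_eq_iff)
  moreover have "card (nbrs E v) = card ?R + card (nbrs E u \<inter> nbrs E v) + 1"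
  proof -
    have "nbrs E v = insert u (?R \<union> (nbrs E u \<inter> nbrs E v))" using uN by blast
    moreover have "card (insert u (?R \<union> (nbrs E u \<inter> nbrs E v))) = card (?R \<union> (nbrs E u \<inter> nbrs E v)) + 1"
      using finN uN by simp
    moreover have "card (?R \<union> (nbrs E u \<inter> nbrs E v)) = card ?R + card (nbrs E u \<inter> nbrs E v)"
      using finN by (intro card_Un_disjoint) auto
    ultimately show ?thesis by simp
  qed
  moreover have "card E = card {e\<in>E. v \<notin> e} + card (nbrs E v)"
  proof -
    have "E = {e\<in>E. v \<notin> e} \<union> {e\<in>E. v \<in> e}" by blast
    then have "card E = card ({e\<in>E. v \<notin> e} \<union> {e\<in>E. v \<in> e})" by simp
    also have "\<dots> = card {e\<in>E. v \<notin> e} + card {e\<in>E. v \<in> e}"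
      using fin by (intro card_Un_disjoint) auto
    finally show ?thesis using degree_eq_card_nbrs[OF assms(1), of v] by (simp add: degree_def)
  qed
  ultimately show ?thesis by simp
qed

text \<open>Nine of the edges make \<open>{v, x, y, b, c}\<close> complete up to
  \<open>{x, y}\<close>; contracting \<open>a\<close> into \<open>x\<close> supplies this one
  through \<open>{a, y}\<close>.\<close>

lemma no_K5_contracted:
  assumes G: "simple_graph V E" "drawable V E"
    and S: "{v, x, y, a, b, c} \<subseteq> V" "distinct [v, x, y, a, b, c]"
    and E: "{v,x} \<in> E" "{v,y} \<in> E" "{v,b} \<in> E" "{v,c} \<in> E" "{x,b} \<in> E" "{x,c} \<in> E"
      "{y,b} \<in> E" "{y,c} \<in> E" "{b,c} \<in> E" "{x,a} \<in> E" "{a,y} \<in> E"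
  shows False
proof (rule no_K5[OF contract_edges_drawable[OF G(1) E(10) G(2)]])
  show "{v, x, y, b, c} \<subseteq> V - {a}" using S by auto
  show "card {v, x, y, b, c} = 5" using S(2) by simp
  have old: "{s, t} \<in> contract_edges E x a" if "{s, t} \<in> E" "s \<noteq> a" "t \<noteq> a" for s t
    using that unfolding contract_edges_def by auto
  have new: "{x, y} \<in> contract_edges E x a" "{y, x} \<in> contract_edges E x a"
    using E S(2) unfolding contract_edges_def by (auto simp: insert_commute)
  fix s t assume "s \<in> {v, x, y, b, c}" "t \<in> {v, x, y, b, c}" "s \<noteq> t"
  then consider "{s, t} = {x, y}" | "{s, t} \<in> E" "s \<noteq> a" "t \<noteq> a"
    using E S(2) by (auto simp: insert_commute)
  then show "{s, t} \<in> contract_edges E x a"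
    by cases (use new old in auto)
qed

text \<open>Induction on the number of vertices. In a counterexample thinned to
  \<open>3 * card V - 5\<close> edges, losing a vertex lowers the bound by 3, so contractions force
  three common neighbours for every edge and deletions force degree at least 4. The forbidden minor
  sits at a vertex of degree 4 or 5.\<close>

lemma drawable_edge_bound:
  assumes "simple_graph V E" "drawable V E" "card V \<ge> 3"
  shows "card E + 6 \<le> 3 * card V"
  using assms
proof (induction "card V" arbitrary: V E rule: less_induct)
  case less
  note G = less.prems(1) and D = less.prems(2)
  have finV: "finite V" using G unfolding simple_graph_def by blast
  show ?case
  proof (rule ccontr)
    assume neg: "\<not> ?thesis"
    then have "3 * card V - 5 \<le> card E" using less.prems(3) by linarith
    then obtain E0 where E0: "E0 \<subseteq> E" "card E0 = 3 * card V - 5"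
      using obtain_subset_with_card_n by metis
    note G0 = simple_graph_mono[OF G E0(1)] and D0 = drawable_mono[OF D subset_refl E0(1)]
    \<comment> \<open>Here the induction hypothesis is out of reach, as it asks for three vertices
      after a removal.\<close>
    have "card V \<noteq> 3"
    proof
      assume "card V = 3"
      have "E \<subseteq> {e. e \<subseteq> V \<and> card e = 2}" using G unfolding simple_graph_def by blast
      then have "card E \<le> card {e. e \<subseteq> V \<and> card e = 2}"
        using finV by (intro card_mono) auto
      also have "\<dots> = 3" using n_subsets[OF finV] \<open>card V = 3\<close> by (simp add: choose_two)
      finally show False using neg \<open>card V = 3\<close> by simp
    qed
    then have V4: "card V \<ge> 4" using less.prems(3) by simp
    have cardVv: "card (V - {v}) = card V - 1" if "v \<in> V" for v using that finV by simp
    have finN: "finite (nbrs E0 v)" for v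
      by (rule finite_nbrs[OF G0])
    have common: "card (nbrs E0 u \<inter> nbrs E0 v) \<ge> 3" if uv: "{u, v} \<in> E0" for u v
    proof -
      have v: "v \<in> V" using simple_graph_edgeD[OF G0 uv] by simp
      have "card (contract_edges E0 u v) + 6 \<le> 3 * card (V - {v})"
        using contract_edges_simple[OF G0 uv] contract_edges_drawable[OF G0 uv D0] v V4 finV
        by (intro less.hyps) (auto simp: cardVv card_gt_0_iff)
      then show ?thesis
        using card_contract_edges[OF G0 uv] E0(2) V4 cardVv[OF v] by simp
    qed
    have mindeg: "card (nbrs E0 v) \<ge> 4" if v: "v \<in> V" for v
    proof -
      let ?E = "{e\<in>E0. v \<notin> e}"
      have G1: "simple_graph (V - {v}) ?E" using G0 unfolding simple_graph_def by auto
      have D1: "drawable (V - {v}) ?E" by (rule drawable_mono[OF D0]) auto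
      have "card ?E + 6 \<le> 3 * card (V - {v})"
        using G1 D1 v V4 finV by (intro less.hyps) (auto simp: cardVv card_gt_0_iff)
      moreover have "card E0 = card ?E + card (nbrs E0 v)"
      proof -
        have "card (?E \<union> {e\<in>E0. v \<in> e}) = card ?E + card {e\<in>E0. v \<in> e}"
          using simple_graph_finite[OF G0] by (intro card_Un_disjoint) auto
        moreover have "?E \<union> {e\<in>E0. v \<in> e} = E0" by blast
        ultimately show ?thesis
          using degree_eq_card_nbrs[OF G0, of v] by (simp add: degree_def)
      qed
      ultimately show ?thesis using E0(2) V4 cardVv[OF v] by simp
    qed
    \<comment> \<open>Otherwise the degree sum would be at least \<open>6 * card V\<close>, but it
      is \<open>6 * card V - 10\<close>.\<close>
    have "\<exists>v\<in>V. card (nbrs E0 v) \<le> 5"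
    proof (rule ccontr)
      assume "\<not> ?thesis"
      then have "\<And>v. v \<in> V \<Longrightarrow> 6 \<le> degree E0 v"
        unfolding degree_eq_card_nbrs[OF G0] by force
      then have "card V * 6 \<le> (\<Sum>v\<in>V. degree E0 v)"
        using sum_bounded_below[of V 6 "degree E0"] by simp
      also have "\<dots> = 2 * card E0"
        using G0 finV by (intro sum_degree) (auto simp: simple_graph_def)
      finally show False using E0(2) V4 by simp
    qed
    then obtain v where v: "v \<in> V" "card (nbrs E0 v) \<le> 5" by blast
    let ?N = "nbrs E0 v"
    have NV: "?N \<subseteq> V" "v \<notin> ?N" using nbrs_subset[OF G0, of v] by auto
    have vN: "{v, w} \<in> E0" "{w, v} \<in> E0" if "w \<in> ?N" for w
      using that by (auto simp: nbrs_def insert_commute)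
    \<comment> \<open>Four mutually adjacent neighbours would form a \<open>K\<^sub>5\<close> with
      \<open>v\<close>.\<close>
    have no_clique: "\<exists>x\<in>S. \<exists>y\<in>S. x \<noteq> y \<and> {x, y} \<notin> E0" if S: "S \<subseteq> ?N" "card S = 4" for S
    proof (rule ccontr)
      assume no: "\<not> ?thesis"
      show False
      proof (rule no_K5[OF D0])
        show "insert v S \<subseteq> V" using S NV v by auto
        show "card (insert v S) = 5" using S NV finite_subset[OF S(1) finN] by (subst card_insert_disjoint) auto
        show "{x, y} \<in> E0" if "x \<in> insert v S" "y \<in> insert v S" "x \<noteq> y" for x y
          using that no S(1) vN by blast
      qed
    qed
    have w3: "card (?N \<inter> nbrs E0 w) \<ge> 3" "?N \<inter> nbrs E0 w \<subseteq> ?N - {w}" if "w \<in> ?N" for w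
      using common[OF vN(1)[OF that]] nbrs_subset[OF G0, of w] by auto
    have "card ?N \<noteq> 4"
    proof
      assume 4: "card ?N = 4"
      have "{w, x} \<in> E0" if "w \<in> ?N" "x \<in> ?N" "w \<noteq> x" for w x
      proof -
        have "?N \<inter> nbrs E0 w = ?N - {w}"
          using w3[OF that(1)] that(1) 4 finN by (intro card_seteq) auto
        then show ?thesis using that by (auto simp: nbrs_def)
      qed
      then show False using no_clique[of ?N] 4 by blast
    qed
    then have 5: "card ?N = 5" using v mindeg[OF v(1)] by simp
    \<comment> \<open>With five neighbours, one that misses two of the others would keep only two
      inside \<open>?N\<close>; so nonadjacent pairs in \<open>?N\<close> are disjoint.\<close>
    have adj: "{w, y} \<in> E0" if "w \<in> ?N" "x \<in> ?N" "y \<in> ?N" "w \<noteq> x" "w \<noteq> y" "x \<noteq> y" "{w, x} \<notin> E0" for w x y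
    proof (rule ccontr)
      assume "{w, y} \<notin> E0"
      then have "?N \<inter> nbrs E0 w \<subseteq> ?N - {w, x, y}"
        using w3(2)[OF that(1)] that by (auto simp: nbrs_def)
      then have "card (?N \<inter> nbrs E0 w) \<le> card (?N - {w, x, y})"
        using finN by (intro card_mono) auto
      also have "\<dots> = 2" using 5 that finN by (simp add: card_Diff_subset)
      finally show False using w3(1)[OF that(1)] by simp
    qed
    have adj': "{y, w} \<in> E0" if "w \<in> ?N" "x \<in> ?N" "y \<in> ?N" "w \<noteq> x" "w \<noteq> y" "x \<noteq> y" "{w, x} \<notin> E0" for w x y
      using adj[OF that] by (simp add: insert_commute)
    obtain S where S: "S \<subseteq> ?N" "card S = 4"
      using obtain_subset_with_card_n[of 4 ?N] 5 by auto
    obtain x y where xy: "x \<in> ?N" "y \<in> ?N" "x \<noteq> y" "{x, y} \<notin> E0"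
      using no_clique[OF S] S(1) by blast
    then have yx: "{y, x} \<notin> E0" by (simp add: insert_commute)
    \<comment> \<open>A second nonadjacent pair is found among the four neighbours other than
      \<open>y\<close>. As \<open>y\<close> is the only neighbour not adjacent to \<open>x\<close>,
      this pair avoids \<open>x\<close> too.\<close>
    have "card (?N - {x, y}) = 3" using 5 xy finN by (simp add: card_Diff_subset)
    then have "card (insert x (?N - {x, y})) = 4" using finN by simp
    then obtain a b where ab: "a \<in> insert x (?N - {x, y})" "b \<in> insert x (?N - {x, y})" "a \<noteq> b" "{a, b} \<notin> E0"
      using no_clique[of "insert x (?N - {x, y})"] xy by auto
    have "a \<noteq> x" "b \<noteq> x" using ab adj[of x y b] adj'[of x y a] xy by auto
    then have ab': "a \<in> ?N" "b \<in> ?N" "a \<noteq> x" "a \<noteq> y" "b \<noteq> x" "b \<noteq> y" using ab by auto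
    have "card (?N - {x, y, a, b}) = 1" using 5 xy ab ab' finN by (simp add: card_Diff_subset)
    then obtain c where "c \<in> ?N - {x, y, a, b}" by (metis card_1_singletonE insertI1)
    then have c: "c \<in> ?N" "c \<noteq> x" "c \<noteq> y" "c \<noteq> a" "c \<noteq> b" by auto
    show False
    proof (rule no_K5_contracted[OF G0 D0])
      show "{v, x, y, a, b, c} \<subseteq> V" using NV v xy ab' c by auto
      show "distinct [v, x, y, a, b, c]" using NV xy ab ab' c by auto
      show "{v, x} \<in> E0" "{v, y} \<in> E0" "{v, b} \<in> E0" "{v, c} \<in> E0" using vN xy ab' c by auto
      show "{x, b} \<in> E0" "{x, c} \<in> E0" "{x, a} \<in> E0"
        using adj[of x y] xy ab' c by auto
      show "{y, b} \<in> E0" "{y, c} \<in> E0" "{a, y} \<in> E0"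
        using adj[of y x] adj'[of y x] xy yx ab' c by auto
      show "{b, c} \<in> E0" using adj[of b a c] ab ab' c by (auto simp: insert_commute)
    qed
  qed
qed

section \<open>List colouring of bipartite edge sets\<close>

text \<open>Deferred acceptance, with smaller ranks preferred and edges given abstractly by their
  two ends. \<open>T\<close> holds the best edge at every \<alpha>-end. If two of them share a
  \<beta>-end, the worse one is deleted: the better one is matched, or beaten at its \<beta>-end
  only, so the deleted edge stays beaten.\<close>

lemma stable_matching_exists:
  fixes rA rB :: "'e \<Rightarrow> nat"
  assumes "finite S"
    and "\<And>e f. e \<in> S \<Longrightarrow> f \<in> S \<Longrightarrow> \<alpha> e = \<alpha> f \<Longrightarrow> rA e = rA f \<Longrightarrow> e = f"
    and "\<And>e f. e \<in> S \<Longrightarrow> f \<in> S \<Longrightarrow> \<beta> e = \<beta> f \<Longrightarrow> rB e = rB f \<Longrightarrow> e = f"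
  shows "\<exists>M\<subseteq>S. inj_on \<alpha> M \<and> inj_on \<beta> M \<and>
    (\<forall>e\<in>S - M. \<exists>f\<in>M. (\<alpha> f = \<alpha> e \<and> rA f < rA e) \<or> (\<beta> f = \<beta> e \<and> rB f < rB e))"
  using assms
proof (induction "card S" arbitrary: S rule: less_induct)
  case less
  note injA = less.prems(2) and injB = less.prems(3)
  define T where "T = {e\<in>S. \<forall>f\<in>S. \<alpha> f = \<alpha> e \<longrightarrow> rA e \<le> rA f}"
  have injT: "inj_on \<alpha> T"
  proof (rule inj_onI)
    fix x y assume xy: "x \<in> T" "y \<in> T" "\<alpha> x = \<alpha> y"
    then have "rA x = rA y" unfolding T_def by (auto intro: le_antisym)
    then show "x = y" using injA[of x y] xy unfolding T_def by auto
  qed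
  show ?case
  proof (cases "inj_on \<beta> T")
    case True
    have "\<exists>f\<in>T. \<alpha> f = \<alpha> e \<and> rA f < rA e" if e: "e \<in> S - T" for e
    proof -
      obtain f where f: "f \<in> S \<and> \<alpha> f = \<alpha> e" "\<And>g. g \<in> S \<and> \<alpha> g = \<alpha> e \<Longrightarrow> rA f \<le> rA g"
        using ex_has_least_nat[of "\<lambda>f. f \<in> S \<and> \<alpha> f = \<alpha> e" e rA] e by blast
      then have "f \<in> T" unfolding T_def by simp
      moreover have "rA f < rA e"
        using f e injA[of f e] \<open>f \<in> T\<close> by (metis DiffD1 DiffD2 le_neq_implies_less)
      ultimately show ?thesis using f by blast
    qed
    then show ?thesis
      using injT True by (intro exI[of _ T]) (auto simp: T_def)
  next
    case False
    then obtain x y where xy: "x \<in> T" "y \<in> T" "x \<noteq> y" "\<beta> x = \<beta> y"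
      unfolding inj_on_def by blast
    then have "rB x \<noteq> rB y" using injB[of x y] unfolding T_def by auto
    then have "rB x < rB y \<or> rB y < rB x" by linarith
    then obtain e e' where ee: "e' \<in> T" "e \<in> T" "\<beta> e' = \<beta> e" "rB e' < rB e"
      using xy by metis
    have S: "e \<in> S" "e' \<in> S" using ee unfolding T_def by auto
    have "card (S - {e}) < card S"
      using S(1) less.prems(1) by (meson card_Diff1_less)
    then have "\<exists>M\<subseteq>S - {e}. inj_on \<alpha> M \<and> inj_on \<beta> M \<and>
        (\<forall>g\<in>S - {e} - M. \<exists>f\<in>M. (\<alpha> f = \<alpha> g \<and> rA f < rA g) \<or> (\<beta> f = \<beta> g \<and> rB f < rB g))"
      by (rule less.hyps) (use less.prems in auto)
    then obtain M where M: "M \<subseteq> S - {e}" "inj_on \<alpha> M" "inj_on \<beta> M"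
      "\<And>g. g \<in> S - {e} - M \<Longrightarrow> \<exists>f\<in>M. (\<alpha> f = \<alpha> g \<and> rA f < rA g) \<or> (\<beta> f = \<beta> g \<and> rB f < rB g)"
      by (elim exE conjE) blast
    have "\<exists>f\<in>M. \<beta> f = \<beta> e \<and> rB f < rB e"
    proof (cases "e' \<in> M")
      case False
      then have "e' \<in> S - {e} - M" using S ee by auto
      then obtain f where f: "f \<in> M" "(\<alpha> f = \<alpha> e' \<and> rA f < rA e') \<or> (\<beta> f = \<beta> e' \<and> rB f < rB e')"
        using M(4) by blast
      have "\<not> (\<alpha> f = \<alpha> e' \<and> rA f < rA e')"
        using ee(1) f(1) M(1) unfolding T_def by fastforce
      then show ?thesis using f ee by force
    qed (use ee in blast)
    then show ?thesis using M by (intro exI[of _ M]) blast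
  qed
qed

text \<open>Galvin's kernel method: give one colour to a stable matching among the edges that admit it; every
  other such edge loses a colour but also one of the edges preferred to it.\<close>
lemma bipartite_list_colouring:
  fixes rA rB :: "'e \<Rightarrow> nat" and L :: "'e \<Rightarrow> 'c set"
  assumes "finite F"
    and "\<And>e f. e \<in> F \<Longrightarrow> f \<in> F \<Longrightarrow> \<alpha> e = \<alpha> f \<Longrightarrow> rA e = rA f \<Longrightarrow> e = f"
    and "\<And>e f. e \<in> F \<Longrightarrow> f \<in> F \<Longrightarrow> \<beta> e = \<beta> f \<Longrightarrow> rB e = rB f \<Longrightarrow> e = f"
    and "\<And>e. e \<in> F \<Longrightarrow> card {f\<in>F. \<alpha> f = \<alpha> e \<and> rA f < rA e} + card {f\<in>F. \<beta> f = \<beta> e \<and> rB f < rB e} < card (L e)"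
  shows "\<exists>c. (\<forall>e\<in>F. c e \<in> L e) \<and> (\<forall>e\<in>F. \<forall>f\<in>F. e \<noteq> f \<and> (\<alpha> e = \<alpha> f \<or> \<beta> e = \<beta> f) \<longrightarrow> c e \<noteq> c f)"
  using assms
proof (induction "card F" arbitrary: F L rule: less_induct)
  case less
  note injA = less.prems(2) and injB = less.prems(3) and fin = less.prems(1) and big = less.prems(4)
  show ?case
  proof (cases "F = {}")
    case False
    then obtain e0 where e0: "e0 \<in> F" by blast
    then have "L e0 \<noteq> {}" using big[OF e0] by auto
    then obtain x where x: "x \<in> L e0" by blast
    define S where "S = {e\<in>F. x \<in> L e}"
    have "\<exists>M\<subseteq>S. inj_on \<alpha> M \<and> inj_on \<beta> M \<and>
      (\<forall>e\<in>S - M. \<exists>f\<in>M. (\<alpha> f = \<alpha> e \<and> rA f < rA e) \<or> (\<beta> f = \<beta> e \<and> rB f < rB e))"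
      by (rule stable_matching_exists) (use fin injA injB in \<open>auto simp: S_def\<close>)
    then obtain M where M: "M \<subseteq> S" "inj_on \<alpha> M" "inj_on \<beta> M"
      "\<And>e. e \<in> S - M \<Longrightarrow> \<exists>f\<in>M. (\<alpha> f = \<alpha> e \<and> rA f < rA e) \<or> (\<beta> f = \<beta> e \<and> rB f < rB e)"
      by blast
    have MF: "M \<subseteq> F" using M(1) S_def by auto
    have "e0 \<in> S" using e0 x S_def by simp
    then have "M \<noteq> {}" using M(4)[of e0] by blast
    then have smaller: "card (F - M) < card F"
      using MF fin by (intro psubset_card_mono) auto
    have "\<exists>c. (\<forall>e\<in>F - M. c e \<in> L e - {x}) \<and>
      (\<forall>e\<in>F - M. \<forall>f\<in>F - M. e \<noteq> f \<and> (\<alpha> e = \<alpha> f \<or> \<beta> e = \<beta> f) \<longrightarrow> c e \<noteq> c f)"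
    proof (rule less.hyps[OF smaller])
      fix e assume e: "e \<in> F - M"
      let ?A = "\<lambda>G. {f\<in>G. \<alpha> f = \<alpha> e \<and> rA f < rA e}" and ?B = "\<lambda>G. {f\<in>G. \<beta> f = \<beta> e \<and> rB f < rB e}"
      have le: "card (?A (F - M)) \<le> card (?A F)" "card (?B (F - M)) \<le> card (?B F)"
        using fin by (auto intro!: card_mono)
      have bige: "card (?A F) + card (?B F) < card (L e)" using big e by blast
      show "card (?A (F - M)) + card (?B (F - M)) < card (L e - {x})"
      proof (cases "x \<in> L e")
        case True
        then obtain f where f: "f \<in> M" "f \<in> ?A F \<or> f \<in> ?B F"
          using M(4)[of e] e MF unfolding S_def by blast
        have "card (?A (F - M)) < card (?A F) \<or> card (?B (F - M)) < card (?B F)"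
          using f(2)
        proof
          assume "f \<in> ?A F"
          then have "?A (F - M) \<subset> ?A F" using f(1) by blast
          then show ?thesis using fin by (simp add: psubset_card_mono)
        next
          assume "f \<in> ?B F"
          then have "?B (F - M) \<subset> ?B F" using f(1) by blast
          then show ?thesis using fin by (simp add: psubset_card_mono)
        qed
        \<comment> \<open>The bound \<open>bige\<close> makes \<open>card (L e)\<close> positive,
          which rules out an infinite list, whose cardinality would be 0.\<close>
        moreover have "card (L e) = Suc (card (L e - {x}))"
          using True bige by (intro card.remove card_ge_0_finite) auto
        ultimately show ?thesis using le bige by linarith
      next
        case False
        then show ?thesis using le bige by simp
      qed
    qed (use fin injA injB in auto)
    then obtain c where c: "\<forall>e\<in>F - M. c e \<in> L e - {x}"
      "\<forall>e\<in>F - M. \<forall>f\<in>F - M. e \<noteq> f \<and> (\<alpha> e = \<alpha> f \<or> \<beta> e = \<beta> f) \<longrightarrow> c e \<noteq> c f"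
      by (elim exE conjE)
    let ?c = "\<lambda>e. if e \<in> M then x else c e"
    have "?c e \<in> L e" if "e \<in> F" for e
      using that c(1) M(1) unfolding S_def by auto
    moreover have "?c e \<noteq> ?c f" if h: "e \<in> F" "f \<in> F" "e \<noteq> f" "\<alpha> e = \<alpha> f \<or> \<beta> e = \<beta> f" for e f
    proof -
      have "\<not> (e \<in> M \<and> f \<in> M)" using h M(2,3) unfolding inj_on_def by blast
      moreover have "c e \<noteq> x" if "e \<in> F - M" for e using c(1) that by blast
      moreover have "c e \<noteq> c f" if "e \<notin> M" "f \<notin> M" using c(2) h that by blast
      ultimately show ?thesis using h(1,2) by (cases "e \<in> M"; cases "f \<in> M"; force)
    qed
    ultimately show ?thesis by (intro exI[of _ ?c]) blast
  qed simp
qed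

section \<open>Assignments of bounded multiplicity\<close>

lemma rtranclp_distinct_path:
  assumes "r\<^sup>*\<^sup>* x y"
  shows "\<exists>xs. distinct (x # xs) \<and> successively r (x # xs) \<and> last (x # xs) = y"
  using assms
proof (induction rule: converse_rtranclp_induct)
  case base
  show ?case by (intro exI[of _ "[]"]) simp
next
  case (step x z)
  then obtain zs where zs: "distinct (z # zs)" "successively r (z # zs)" "last (z # zs) = y" by blast
  show ?case
  proof (cases "x \<in> set (z # zs)")
    case True
    \<comment> \<open>If \<open>x\<close> recurs on the path, the part from that occurrence on
      suffices.\<close>
    then obtain us vs where "z # zs = us @ x # vs" by (meson split_list)
    then show ?thesis
      using zs by (intro exI[of _ vs]) (auto simp: successively_append_iff)
  next
    case False
    then show ?thesis using zs step by (intro exI[of _ "z # zs"]) auto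
  qed
qed

text \<open>Induction along the path: \<open>x\<close> takes over the value of its successor
  \<open>y\<close>, which keeps all loads and leaves \<open>y\<close> unassigned. The last vertex
  takes \<open>b\<close>, which has room.\<close>

lemma assignment_augment:
  assumes "finite A" "x \<notin> A" "\<And>a. a \<in> A \<Longrightarrow> \<sigma> a \<in> N a" "\<And>b. card {a\<in>A. \<sigma> a = b} \<le> c"
    and "distinct (x # xs)" "set xs \<subseteq> A" "successively (\<lambda>a a'. \<sigma> a' \<in> N a) (x # xs)"
    and "b \<in> N (last (x # xs))" "card {a\<in>A. \<sigma> a = b} < c"
  shows "\<exists>\<sigma>'. (\<forall>a\<in>insert x A. \<sigma>' a \<in> N a) \<and> (\<forall>b. card {a\<in>insert x A. \<sigma>' a = b} \<le> c)"
  using assms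
proof (induction xs arbitrary: A x \<sigma>)
  case Nil
  have "card {a\<in>insert x A. (\<sigma>(x := b)) a = b'} \<le> c" for b'
  proof (cases "b' = b")
    case True
    then have "{a\<in>insert x A. (\<sigma>(x := b)) a = b'} = insert x {a\<in>A. \<sigma> a = b}"
      using Nil(2) by auto
    then show ?thesis using Nil by simp
  next
    case False
    then have "{a\<in>insert x A. (\<sigma>(x := b)) a = b'} = {a\<in>A. \<sigma> a = b'}"
      using Nil(2) by auto
    then show ?thesis using Nil by simp
  qed
  then show ?case
    using Nil by (intro exI[of _ "\<sigma>(x := b)"]) auto
next
  case (Cons y ys)
  let ?A = "insert x (A - {y})" and ?\<sigma> = "\<sigma>(x := \<sigma> y)"
  have y: "y \<in> A" "y \<noteq> x" "y \<notin> set ys" "x \<notin> set ys" using Cons.prems by auto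
  have load: "card {a\<in>?A. ?\<sigma> a = b'} = card {a\<in>A. \<sigma> a = b'}" for b'
  proof (cases "\<sigma> y = b'")
    case True
    then have "{a\<in>?A. ?\<sigma> a = b'} = insert x ({a\<in>A. \<sigma> a = b'} - {y})"
      using Cons.prems(2) by auto
    moreover have "card \<dots> = Suc (card ({a\<in>A. \<sigma> a = b'} - {y}))"
      using Cons.prems(1,2) by simp
    moreover have "\<dots> = card {a\<in>A. \<sigma> a = b'}"
      using Cons.prems(1) y(1) True by (intro card.remove[symmetric]) auto
    ultimately show ?thesis by simp
  next
    case False
    then have "{a\<in>?A. ?\<sigma> a = b'} = {a\<in>A. \<sigma> a = b'}"
      using Cons.prems(2) by auto
    then show ?thesis by simp
  qed
  have "\<exists>\<sigma>'. (\<forall>a\<in>insert y ?A. \<sigma>' a \<in> N a) \<and> (\<forall>b. card {a\<in>insert y ?A. \<sigma>' a = b} \<le> c)"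
  proof (rule Cons.IH[of ?A y ?\<sigma>])
    show "?\<sigma> a \<in> N a" if "a \<in> ?A" for a
      using that Cons.prems(3,7) by auto
    \<comment> \<open>\<open>?\<sigma>\<close> differs from \<open>\<sigma>\<close> only at
      \<open>x\<close>, which the rest of the path avoids.\<close>
    show "successively (\<lambda>a a'. ?\<sigma> a' \<in> N a) (y # ys)"
    proof (rule successively_mono)
      show "successively (\<lambda>a a'. \<sigma> a' \<in> N a) (y # ys)" using Cons.prems(7) by simp
      show "?\<sigma> a' \<in> N a" if "a \<in> set (y # ys)" "a' \<in> set (y # ys)" "\<sigma> a' \<in> N a" for a a'
        using that y by auto
    qed
    show "card {a\<in>?A. ?\<sigma> a = b'} \<le> c" for b' unfolding load by (rule Cons.prems(4))
    show "card {a\<in>?A. ?\<sigma> a = b} < c" unfolding load by (rule Cons.prems(9))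
  qed (use Cons.prems y in auto)
  moreover have "insert y ?A = insert x A" using y by auto
  ultimately show ?case by simp
qed

text \<open>Elements are added one at a time. From a new \<open>x\<close> the search runs over all
  elements whose values can be taken over in turn. A value with room yields an augmenting path;
  otherwise all values admissible for the reached set \<open>R\<close> are full, and their holders
  belong to \<open>R\<close>.\<close>

lemma assignment_or_saturated:
  assumes "finite A"
  shows "(\<exists>\<sigma>. (\<forall>a\<in>A. \<sigma> a \<in> N a) \<and> (\<forall>b. card {a\<in>A. \<sigma> a = b} \<le> c)) \<or>
    (\<exists>R \<sigma>. R \<noteq> {} \<and> R \<subseteq> A \<and> (\<forall>b\<in>\<Union>(N ` R). c \<le> card {a\<in>R. b \<in> N a \<and> \<sigma> a = b}))"
  using assms
proof (induction A rule: finite_induct)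
  case (insert x A)
  show ?case
  proof (cases "\<exists>R \<sigma>. R \<noteq> {} \<and> R \<subseteq> A \<and> (\<forall>b\<in>\<Union>(N ` R). c \<le> card {a\<in>R. b \<in> N a \<and> \<sigma> a = b})")
    case True
    then show ?thesis by (meson subset_insertI2)
  next
    case False
    then obtain \<sigma> where \<sigma>: "\<And>a. a \<in> A \<Longrightarrow> \<sigma> a \<in> N a" "\<And>b. card {a\<in>A. \<sigma> a = b} \<le> c"
      using insert.IH by blast
    \<comment> \<open>\<open>a\<close> could take over the value held by \<open>a'\<close>.\<close>
    define r where "r = (\<lambda>a a'. a' \<in> A \<and> \<sigma> a' \<in> N a)"
    define R where "R = {a. r\<^sup>*\<^sup>* x a}"
    have RA: "R \<subseteq> insert x A"
    proof
      fix a assume "a \<in> R"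
      then have "r\<^sup>*\<^sup>* x a" unfolding R_def by simp
      then show "a \<in> insert x A" by (cases rule: rtranclp.cases) (auto simp: r_def)
    qed
    have xR: "x \<in> R" unfolding R_def by simp
    show ?thesis
    proof (cases "\<forall>b\<in>\<Union>(N ` R). c \<le> card {a\<in>A. \<sigma> a = b}")
      case True
      have "c \<le> card {a\<in>R. b \<in> N a \<and> \<sigma> a = b}" if b: "b \<in> \<Union>(N ` R)" for b
      proof -
        obtain a where a: "a \<in> R" "b \<in> N a" using b by blast
        have "{a\<in>A. \<sigma> a = b} \<subseteq> {a\<in>R. b \<in> N a \<and> \<sigma> a = b}"
        proof
          fix a' assume a': "a' \<in> {a\<in>A. \<sigma> a = b}"
          then have "r a a'" using a unfolding r_def by auto
          then have "a' \<in> R" using a(1) unfolding R_def by (auto intro: rtranclp.rtrancl_into_rtrancl)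
          then show "a' \<in> {a\<in>R. b \<in> N a \<and> \<sigma> a = b}" using a' \<sigma>(1) by auto
        qed
        then have "card {a\<in>A. \<sigma> a = b} \<le> card {a\<in>R. b \<in> N a \<and> \<sigma> a = b}"
          using RA insert.hyps(1) by (intro card_mono) (auto intro: finite_subset)
        then show ?thesis using True b by fastforce
      qed
      then show ?thesis using RA xR by blast
    next
      case False
      then obtain y b where y: "y \<in> R" "b \<in> N y" "card {a\<in>A. \<sigma> a = b} < c" by (auto simp: not_le)
      then obtain xs where xs: "distinct (x # xs)" "successively r (x # xs)" "last (x # xs) = y"
        using rtranclp_distinct_path[of r x y] unfolding R_def by blast
      have "set xs \<subseteq> A"
        using xs(2) by (induction xs arbitrary: x) (auto simp: r_def)
      moreover have "successively (\<lambda>a a'. \<sigma> a' \<in> N a) (x # xs)"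
        by (rule successively_mono[OF xs(2)]) (simp add: r_def)
      ultimately show ?thesis
        using assignment_augment[of A x \<sigma> N c xs b] insert.hyps \<sigma> xs y by blast
    qed
  qed
qed simp

text \<open>Apply \<open>bipartite_list_colouring\<close> with the owned edges \<open>Ow\<close> ranked first at their \<open>\<alpha>\<close>-end and
  last at their \<open>\<beta>\<close>-end.\<close>
lemma bipartite_list_colouring_owned:
  fixes L :: "'e \<Rightarrow> 'c set"
  assumes fin: "finite F" and O: "Ow \<subseteq> F" "inj_on \<alpha> Ow"
    and degA: "\<And>e. e \<in> F \<Longrightarrow> card {f\<in>F. \<alpha> f = \<alpha> e} \<le> Suc k"
    and own: "\<And>e. e \<in> F \<Longrightarrow> k \<le> card {f\<in>Ow. \<beta> f = \<beta> e}"
    and L: "\<And>e. e \<in> F \<Longrightarrow> card {f\<in>F. \<beta> f = \<beta> e} \<le> card (L e)"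
  shows "\<exists>c. (\<forall>e\<in>F. c e \<in> L e) \<and> (\<forall>e\<in>F. \<forall>f\<in>F. e \<noteq> f \<and> (\<alpha> e = \<alpha> f \<or> \<beta> e = \<beta> f) \<longrightarrow> c e \<noteq> c f)"
proof -
  obtain idx :: "'e \<Rightarrow> nat" and n where idx: "idx ` F = {i. i < n}" "inj_on idx F"
    using finite_imp_inj_to_nat_seg[OF fin] by metis
  then have idx_less: "idx e < n" if "e \<in> F" for e using that by auto
  define rA where "rA = (\<lambda>e. if e \<in> Ow then 0 else Suc (idx e))"
  define rB where "rB = (\<lambda>e. if e \<in> Ow then n + idx e else idx e)"
  show ?thesis
  proof (rule bipartite_list_colouring[of F \<alpha> rA \<beta> rB])
    show "e = f" if "e \<in> F" "f \<in> F" "\<alpha> e = \<alpha> f" "rA e = rA f" for e f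
      using that O(2) idx(2) unfolding rA_def inj_on_def by (auto split: if_splits)
    show "e = f" if "e \<in> F" "f \<in> F" "\<beta> e = \<beta> f" "rB e = rB f" for e f
      using that idx(2) idx_less[of e] idx_less[of f] unfolding rB_def inj_on_def by (auto split: if_splits)
    fix e assume e: "e \<in> F"
    let ?A = "{f\<in>F. \<alpha> f = \<alpha> e \<and> rA f < rA e}" and ?B = "{f\<in>F. \<beta> f = \<beta> e \<and> rB f < rB e}"
    have pos: "card ({f\<in>F. P f} - {e}) < card {f\<in>F. P f}" if "P e" for P
      using e that fin by (intro card_Diff1_less) auto
    have "card ?A + card ?B < card {f\<in>F. \<beta> f = \<beta> e}"
    proof (cases "e \<in> Ow")
      case True
      then have "?A = {}" by (auto simp: rA_def)
      then have "card ?A = 0" by (simp only: card.empty)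
      moreover have "card ?B \<le> card ({f\<in>F. \<beta> f = \<beta> e} - {e})"
        using fin by (intro card_mono) auto
      moreover have "card ({f\<in>F. \<beta> f = \<beta> e} - {e}) < card {f\<in>F. \<beta> f = \<beta> e}"
        by (rule pos) simp
      ultimately show ?thesis by linarith
    next
      case False
      have "card ?A \<le> card ({f\<in>F. \<alpha> f = \<alpha> e} - {e})"
        using fin by (intro card_mono) auto
      moreover have "card ({f\<in>F. \<alpha> f = \<alpha> e} - {e}) < card {f\<in>F. \<alpha> f = \<alpha> e}"
        by (rule pos) simp
      ultimately have A: "card ?A \<le> k" using degA[OF e] by linarith
      \<comment> \<open>At least \<open>k\<close> owned edges rank after \<open>e\<close> at its
        \<beta>-end, which makes up for the at most \<open>k\<close> competitors at its
        \<alpha>-end.\<close>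
      let ?O = "{f\<in>Ow. \<beta> f = \<beta> e}"
      have "?B \<subseteq> {f\<in>F. \<beta> f = \<beta> e} - insert e ?O"
        using False idx_less[OF e] by (auto simp: rB_def)
      then have "card ?B \<le> card ({f\<in>F. \<beta> f = \<beta> e} - insert e ?O)"
        using fin by (intro card_mono) auto
      moreover have "card ({f\<in>F. \<beta> f = \<beta> e} - insert e ?O) = card {f\<in>F. \<beta> f = \<beta> e} - card (insert e ?O)"
        using fin O(1) e by (intro card_Diff_subset) (auto intro: finite_subset)
      moreover have "card (insert e ?O) = Suc (card ?O)"
        using False fin O(1) by (simp add: finite_subset)
      moreover have "card (insert e ?O) \<le> card {f\<in>F. \<beta> f = \<beta> e}"
        using fin O(1) e by (intro card_mono) auto
      ultimately show ?thesis using A own[OF e] by linarith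
    qed
    then show "card ?A + card ?B < card (L e)" using L[OF e] by linarith
  qed (rule fin)
qed

section \<open>List edge colouring of sparse graphs\<close>

definition proper_from :: "'a set set \<Rightarrow> ('a set \<Rightarrow> 'c set) \<Rightarrow> ('a set \<Rightarrow> 'c) \<Rightarrow> bool" where
  "proper_from E L c \<longleftrightarrow> (\<forall>e\<in>E. c e \<in> L e) \<and> (\<forall>e\<in>E. \<forall>f\<in>E. e \<noteq> f \<and> e \<inter> f \<noteq> {} \<longrightarrow> c e \<noteq> c f)"

text \<open>The lists for \<open>F\<close> lack the colours of touching edges of \<open>D\<close>,
  so the two colourings cannot clash.\<close>

lemma proper_from_extend:
  assumes "proper_from D L c" "proper_from F (\<lambda>e. L e - c ` {f\<in>D. f \<inter> e \<noteq> {}}) d"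
  shows "proper_from (D \<union> F) L (\<lambda>e. if e \<in> F then d e else c e)"
  unfolding proper_from_def
proof (intro conjI ballI impI)
  fix e assume e: "e \<in> D \<union> F"
  then show "(if e \<in> F then d e else c e) \<in> L e"
    using assms unfolding proper_from_def by auto
  fix f assume f: "f \<in> D \<union> F" and ef: "e \<noteq> f \<and> e \<inter> f \<noteq> {}"
  have mixed: "d e \<noteq> c f" if "e \<in> F" "f \<in> D" "e \<inter> f \<noteq> {}" for e f
  proof -
    have "d e \<notin> c ` {f\<in>D. f \<inter> e \<noteq> {}}"
      using assms(2) that(1) unfolding proper_from_def by blast
    then show ?thesis using that by (auto simp: Int_commute)
  qed
  show "(if e \<in> F then d e else c e) \<noteq> (if f \<in> F then d f else c f)"
    using assms e f ef mixed[of e f] mixed[of f e] unfolding proper_from_def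
    by (auto simp: Int_commute)
qed

text \<open>Each touching edge spoils at most one colour. The additive form avoids truncated
  subtraction.\<close>

lemma card_residual:
  assumes "finite D"
  shows "card (L e) \<le> card (L e - c ` {f\<in>D. f \<inter> e \<noteq> {}}) + card {f\<in>D. f \<inter> e \<noteq> {}}"
proof -
  have fin: "finite {f\<in>D. f \<inter> e \<noteq> {}}" using assms by simp
  have "card (L e) - card (c ` {f\<in>D. f \<inter> e \<noteq> {}}) \<le> card (L e - c ` {f\<in>D. f \<inter> e \<noteq> {}})"
    using fin by (intro diff_card_le_card_Diff) simp
  moreover have "card (c ` {f\<in>D. f \<inter> e \<noteq> {}}) \<le> card {f\<in>D. f \<inter> e \<noteq> {}}"
    by (rule card_image_le[OF fin])
  ultimately show ?thesis by linarith
qed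

text \<open>\<open>{u, v}\<close> meets at most \<open>degree E u + degree E v - 2\<close> other
  edges, fewer than its list has colours.\<close>

lemma extend_light_edge:
  assumes G: "simple_graph V E" and e: "{u, v} \<in> E"
    and c: "proper_from (E - {{u, v}}) L c"
    and light: "degree E u + degree E v < card (L {u, v}) + 2"
  shows "\<exists>c. proper_from E L c"
proof -
  let ?e = "{u, v}" and ?D = "E - {{u, v}}"
  have fin: "finite E" using simple_graph_finite[OF G] .
  let ?X = "{f\<in>?D. f \<inter> ?e \<noteq> {}}"
  have "?X \<subseteq> ({f\<in>E. u \<in> f} - {?e}) \<union> ({f\<in>E. v \<in> f} - {?e})" by blast
  then have "card ?X \<le> card (({f\<in>E. u \<in> f} - {?e}) \<union> ({f\<in>E. v \<in> f} - {?e}))"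
    using fin by (intro card_mono) auto
  also have "\<dots> \<le> card ({f\<in>E. u \<in> f} - {?e}) + card ({f\<in>E. v \<in> f} - {?e})"
    by (rule card_Un_le)
  also have "\<dots> + 2 = degree E u + degree E v"
  proof -
    have "degree E u = Suc (card ({f\<in>E. u \<in> f} - {?e}))" "degree E v = Suc (card ({f\<in>E. v \<in> f} - {?e}))"
      unfolding degree_def using fin e by (intro card.remove; auto)+
    then show ?thesis by simp
  qed
  finally have "card ?X + 2 \<le> degree E u + degree E v" by simp
  then have "card (L ?e - c ` ?X) > 0"
    using card_residual[of ?D L ?e c] fin light by simp
  then have "L ?e - c ` ?X \<noteq> {}" by (metis card.empty less_irrefl)
  then obtain x where "x \<in> L ?e - c ` ?X" by blast
  then have "proper_from {?e} (\<lambda>e. L e - c ` {f\<in>?D. f \<inter> e \<noteq> {}}) (\<lambda>_. x)"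
    unfolding proper_from_def by auto
  from proper_from_extend[OF c this] have "\<exists>c. proper_from (?D \<union> {?e}) L c" by blast
  moreover have "?D \<union> {?e} = E" using e by blast
  ultimately show ?thesis by simp
qed

text \<open>Minimality colours all edges away from \<open>R\<close>; the others form a bipartite
  graph between \<open>R\<close> and vertices of degree above 5. Among the coloured edges,
  \<open>{a, b}\<close> meets only those at \<open>b\<close>, so its remaining list is at least as
  large as the number of edges from \<open>b\<close> to \<open>R\<close>, as the kernel method
  requires.\<close>

lemma extend_saturated:
  assumes G: "simple_graph V E" and R: "R \<subseteq> \<Union>E" "R \<noteq> {}" "k \<le> 4"
    and low: "\<And>a. a \<in> R \<Longrightarrow> degree E a \<le> Suc k"
    and high: "\<And>a b. a \<in> R \<Longrightarrow> {a, b} \<in> E \<Longrightarrow> degree E b > 5"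
    and sat: "\<And>a b. a \<in> R \<Longrightarrow> {a, b} \<in> E \<Longrightarrow> k \<le> card {a\<in>R. {a, b} \<in> E \<and> \<sigma> a = b}"
    and L: "\<And>a b. a \<in> R \<Longrightarrow> {a, b} \<in> E \<Longrightarrow> degree E b \<le> card (L {a, b})"
    and smaller: "\<And>D. D \<subset> E \<Longrightarrow> \<exists>c. proper_from D L c"
  shows "\<exists>c. proper_from E L c"
proof -
  have fin: "finite E" using simple_graph_finite[OF G] .
  define F where "F = {e\<in>E. e \<inter> R \<noteq> {}}"
  \<comment> \<open>Degree tells the two ends apart: it is at most \<open>Suc k \<le> 5\<close> in
    \<open>R\<close> and above 5 on the other side.\<close>
  define \<alpha> where "\<alpha> = (\<lambda>e. SOME a. a \<in> e \<and> degree E a \<le> 5)"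
  define \<beta> where "\<beta> = (\<lambda>e. SOME b. b \<in> e \<and> degree E b > 5)"
  have low5: "degree E a \<le> 5" if "a \<in> R" for a using low[OF that] R(3) by simp
  have ab: "\<alpha> {a, b} = a \<and> \<beta> {a, b} = b" if "a \<in> R" "{a, b} \<in> E" for a b
    unfolding \<alpha>_def \<beta>_def
    using low5[OF that(1)] high[OF that] by (auto intro!: some_equality)
  have F: "\<exists>a b. e = {a, b} \<and> a \<in> R \<and> {a, b} \<in> E \<and> \<alpha> e = a \<and> \<beta> e = b" if e: "e \<in> F" for e
  proof -
    obtain a where a: "e \<in> E" "a \<in> e" "a \<in> R" using e unfolding F_def by blast
    then obtain b where "e = {a, b}" using simple_graph_edgeE[OF G a(1,2)] by metis
    then show ?thesis using a ab[of a b] by blast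
  qed
  have mem: "\<alpha> e \<in> e" "\<beta> e \<in> e" "e \<in> E" if "e \<in> F" for e
    using F[OF that] by auto
  have "F \<noteq> {}"
    using R(1,2) unfolding F_def by blast
  then have "E - F \<subset> E" unfolding F_def by blast
  then obtain c where c: "proper_from (E - F) L c" using smaller by blast
  let ?L = "\<lambda>e. L e - c ` {f\<in>E - F. f \<inter> e \<noteq> {}}"
  \<comment> \<open>Each \<open>a\<close> owns at most its edge to \<open>\<sigma> a\<close>, and
    \<open>sat\<close> gives every \<beta>-end at least \<open>k\<close> owned edges.\<close>
  define Ow where "Ow = {e\<in>F. \<sigma> (\<alpha> e) = \<beta> e}"
  have "\<exists>d. (\<forall>e\<in>F. d e \<in> ?L e) \<and> (\<forall>e\<in>F. \<forall>f\<in>F. e \<noteq> f \<and> (\<alpha> e = \<alpha> f \<or> \<beta> e = \<beta> f) \<longrightarrow> d e \<noteq> d f)"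
  proof (rule bipartite_list_colouring_owned[where Ow = Ow and k = k])
    show "finite F" using fin unfolding F_def by simp
    show "Ow \<subseteq> F" unfolding Ow_def by blast
    show "inj_on \<alpha> Ow"
    proof (rule inj_onI)
      fix e f assume ef: "e \<in> Ow" "f \<in> Ow" "\<alpha> e = \<alpha> f"
      then have "\<beta> e = \<beta> f" unfolding Ow_def by auto
      moreover have "e = {\<alpha> e, \<beta> e}" "f = {\<alpha> f, \<beta> f}"
        using ef F[of e] F[of f] unfolding Ow_def by auto
      ultimately show "e = f" using ef(3) by simp
    qed
    fix e assume "e \<in> F"
    then obtain a b where e: "e = {a, b}" "a \<in> R" "{a, b} \<in> E" "\<alpha> e = a" "\<beta> e = b"
      using F by blast
    have "{f\<in>F. \<alpha> f = \<alpha> e} \<subseteq> {f\<in>E. a \<in> f}"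
      using mem e(4) by force
    then have "card {f\<in>F. \<alpha> f = \<alpha> e} \<le> card {f\<in>E. a \<in> f}"
      using fin by (intro card_mono) auto
    then show "card {f\<in>F. \<alpha> f = \<alpha> e} \<le> Suc k"
      using low[OF e(2)] unfolding degree_def by linarith
    have "card {a\<in>R. {a, b} \<in> E \<and> \<sigma> a = b} \<le> card {f\<in>Ow. \<beta> f = \<beta> e}"
    proof (rule card_inj_on_le)
      show "inj_on (\<lambda>a. {a, b}) {a\<in>R. {a, b} \<in> E \<and> \<sigma> a = b}"
        by (auto simp: inj_on_def doubleton_eq_iff)
      show "(\<lambda>a. {a, b}) ` {a\<in>R. {a, b} \<in> E \<and> \<sigma> a = b} \<subseteq> {f\<in>Ow. \<beta> f = \<beta> e}"
        using ab e(5) unfolding Ow_def F_def by auto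
      show "finite {f\<in>Ow. \<beta> f = \<beta> e}"
        using fin unfolding Ow_def F_def by simp
    qed
    then show "k \<le> card {f\<in>Ow. \<beta> f = \<beta> e}" using sat[OF e(2,3)] by linarith
    have sub: "{f\<in>F. \<beta> f = \<beta> e} \<subseteq> {f\<in>E. b \<in> f}"
      using mem e(5) by force
    \<comment> \<open>All edges at \<open>a\<close> lie in \<open>F\<close>, so a coloured edge can
      meet \<open>e\<close> only in \<open>b\<close>.\<close>
    have "{f\<in>E - F. f \<inter> e \<noteq> {}} \<subseteq> {f\<in>E. b \<in> f} - {f\<in>F. \<beta> f = \<beta> e}"
      using e(1,2) unfolding F_def by blast
    then have "card {f\<in>E - F. f \<inter> e \<noteq> {}} \<le> card ({f\<in>E. b \<in> f} - {f\<in>F. \<beta> f = \<beta> e})"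
      using fin by (intro card_mono) auto
    also have "\<dots> = degree E b - card {f\<in>F. \<beta> f = \<beta> e}"
      unfolding degree_def using fin sub by (intro card_Diff_subset) (auto simp: F_def)
    finally have "card {f\<in>E - F. f \<inter> e \<noteq> {}} \<le> degree E b - card {f\<in>F. \<beta> f = \<beta> e}" .
    moreover have "card {f\<in>F. \<beta> f = \<beta> e} \<le> degree E b"
      unfolding degree_def using fin sub by (intro card_mono) auto
    moreover have "card (L e) \<le> card (?L e) + card {f\<in>E - F. f \<inter> e \<noteq> {}}"
      using fin by (intro card_residual) auto
    moreover have "degree E b \<le> card (L e)" using L[OF e(2,3)] e(1) by simp
    ultimately show "card {f\<in>F. \<beta> f = \<beta> e} \<le> card (?L e)" by linarith
  qed
  then obtain d where d: "\<And>e. e \<in> F \<Longrightarrow> d e \<in> ?L e"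
    "\<And>e f. e \<in> F \<Longrightarrow> f \<in> F \<Longrightarrow> e \<noteq> f \<Longrightarrow> \<alpha> e = \<alpha> f \<or> \<beta> e = \<beta> f \<Longrightarrow> d e \<noteq> d f"
    by (elim exE conjE) blast
  have "proper_from F ?L d"
    unfolding proper_from_def
  proof (intro conjI ballI impI)
    fix e f assume ef: "e \<in> F" "f \<in> F" and ne: "e \<noteq> f \<and> e \<inter> f \<noteq> {}"
    obtain a b where e: "e = {a, b}" "a \<in> R" "{a, b} \<in> E" "\<alpha> e = a" "\<beta> e = b" using F[OF ef(1)] by blast
    obtain a' b' where f: "f = {a', b'}" "a' \<in> R" "{a', b'} \<in> E" "\<alpha> f = a'" "\<beta> f = b'" using F[OF ef(2)] by blast
    \<comment> \<open>A low end is never a high end, so touching edges agree in \<alpha> or in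
      \<beta>.\<close>
    have "a \<noteq> b'" "b \<noteq> a'"
      using low5[OF e(2)] low5[OF f(2)] high[OF e(2,3)] high[OF f(2,3)] by auto
    then have "a = a' \<or> b = b'" using ne e(1) f(1) by auto
    then show "d e \<noteq> d f" using d(2)[OF ef] ne e(4,5) f(4,5) by auto
  qed (rule d(1))
  from proper_from_extend[OF c this] have "\<exists>c. proper_from (E - F \<union> F) L c" by blast
  moreover have "E - F \<union> F = E" unfolding F_def by blast
  ultimately show ?thesis by simp
qed

text \<open>Discharging: every vertex \<open>a\<close> of degree at most 5 receives one unit from \<open>\<sigma> k a\<close> for each
  \<open>k\<close> with \<open>degree E a \<le> k + 1\<close>, and the vertices of degree at least 16 pay at most
  \<open>0 + 1 + 2 + 3 + 4\<close> each.\<close>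
lemma assignments_imp_dense:
  assumes G: "simple_graph V E"
    and \<sigma>: "\<And>k v. k < 5 \<Longrightarrow> v \<in> \<Union>E \<Longrightarrow> degree E v \<le> Suc k \<Longrightarrow> \<sigma> k v \<in> \<Union>E \<and> degree E (\<sigma> k v) \<ge> 16"
    and load: "\<And>k b. k < 5 \<Longrightarrow> card {v\<in>\<Union>E. degree E v \<le> Suc k \<and> \<sigma> k v = b} \<le> k"
  shows "3 * card (\<Union>E) \<le> card E"
proof -
  have fin: "finite E" using simple_graph_finite[OF G] .
  have finU: "finite (\<Union>E)" using G unfolding simple_graph_def by (auto intro: finite_subset)
  let ?U = "\<Union>E" and ?d = "degree E"
  define M where "M = {v\<in>\<Union>E. degree E v \<ge> 16}"
  have finM: "finite M" unfolding M_def by (rule finite_subset[OF _ finU]) auto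
  define A where "A = (\<lambda>k. {v\<in>\<Union>E. degree E v \<le> Suc k})"
  have A: "card (A k) \<le> k * card M" if k: "k < 5" for k
  proof -
    have "finite (A k)" unfolding A_def by (rule finite_subset[OF _ finU]) auto
    moreover have "\<sigma> k ` A k \<subseteq> M" using \<sigma>[OF k] unfolding A_def M_def by blast
    ultimately have "card (A k) = (\<Sum>b\<in>M. \<Sum>a\<in>{a\<in>A k. \<sigma> k a = b}. 1)"
      using finM by (subst sum.group) auto
    also have "\<dots> \<le> (\<Sum>b\<in>M. k)"
      using load[OF k] by (intro sum_mono) (simp add: A_def conj_assoc del: Union_iff)
    finally show ?thesis by (simp add: mult.commute)
  qed
  have pos: "1 \<le> ?d v" if "v \<in> ?U" for v
  proof -
    have "{e\<in>E. v \<in> e} \<noteq> {}" using that by blast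
    then show ?thesis unfolding degree_def using fin by (simp add: Suc_leI card_gt_0_iff)
  qed
  \<comment> \<open>A vertex of degree \<open>d \<le> 5\<close> receives \<open>6 - d\<close> units,
    for \<open>k\<close> from \<open>d - 1\<close> to 4; \<open>d = 0\<close> would end with only 5,
    hence \<open>pos\<close>. From degree 16 on, paying 10 leaves at least 6.\<close>
  have pt: "6 + (if 16 \<le> ?d v then 10 else 0) \<le> ?d v + (\<Sum>k<5. if ?d v \<le> Suc k then 1 else 0)"
    if "v \<in> ?U" for v
    using pos[OF that] by (auto simp: eval_nat_numeral)
  have "6 * card ?U + 10 * card M = (\<Sum>v\<in>?U. 6 + (if 16 \<le> ?d v then 10 else 0))"
    using finU by (simp add: sum.distrib sum.If_cases M_def Int_def del: Union_iff)
  also have "\<dots> \<le> (\<Sum>v\<in>?U. ?d v + (\<Sum>k<5. if ?d v \<le> Suc k then 1 else 0))"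
    by (rule sum_mono) (rule pt)
  also have "\<dots> = 2 * card E + (\<Sum>k<5. \<Sum>v\<in>?U. if ?d v \<le> Suc k then 1 else 0)"
    unfolding sum.distrib sum_degree[OF G subset_refl finU] by (subst sum.swap) simp
  also have "(\<Sum>k<5. \<Sum>v\<in>?U. if ?d v \<le> Suc k then 1 else 0) = (\<Sum>k<5. card (A k))"
    using finU by (simp add: sum.If_cases A_def Int_def del: Union_iff)
  also have "\<dots> \<le> (\<Sum>k<5. k * card M)"
    using A by (intro sum_mono) simp
  also have "\<dots> = 10 * card M" by (simp add: eval_nat_numeral)
  finally show ?thesis by simp
qed

text \<open>\<open>m\<close> counts the precoloured edges at a vertex, and sparsity is asked of all
  nonempty subsets so that it passes to smaller edge sets. In a minimal counterexample
  \<open>extend_light_edge\<close> makes all edges heavy, \<open>extend_saturated\<close> yields the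
  five assignments, and \<open>assignments_imp_dense\<close> contradicts sparsity. The bound 21 is
  16 + 5: a neighbour of a vertex of degree at most 5 must reach degree 16.\<close>

lemma list_edge_colourable:
  fixes m :: "'a \<Rightarrow> nat"
  assumes "simple_graph V E" and N: "21 \<le> N"
    and "\<And>v. degree E v + m v + 1 \<le> N" and m: "\<And>v. m v \<le> 1"
    and "\<And>u v. {u, v} \<in> E \<Longrightarrow> N \<le> card (L {u, v}) + m u + m v"
    and "\<And>D. D \<subseteq> E \<Longrightarrow> D \<noteq> {} \<Longrightarrow> card D < 3 * card (\<Union>D)"
  shows "\<exists>c. proper_from E L c"
  using assms(1,3,5,6)
proof (induction "card E" arbitrary: E rule: less_induct)
  case less
  note G = less.prems(1) and deg = less.prems(2) and L = less.prems(3) and sparse = less.prems(4)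
  have fin: "finite E" using simple_graph_finite[OF G] .
  have finU: "finite (\<Union>E)" using G unfolding simple_graph_def by (auto intro: finite_subset)
  have smaller: "\<exists>c. proper_from D L c" if D: "D \<subset> E" for D
  proof (rule less.hyps)
    show "card D < card E" using D fin by (rule psubset_card_mono[rotated])
    show "simple_graph V D" using simple_graph_mono[OF G] D by blast
    show "degree D v + m v + 1 \<le> N" for v
    proof -
      have "degree D v \<le> degree E v"
        unfolding degree_def using fin D by (intro card_mono) auto
      then show ?thesis using deg[of v] by linarith
    qed
  qed (use D L sparse in auto)
  show ?case
  proof (rule ccontr)
    assume no: "\<nexists>c. proper_from E L c"
    have heavy: "N \<le> degree E u + degree E v" if uv: "{u, v} \<in> E" for u v
    proof (rule ccontr)
      assume "\<not> N \<le> degree E u + degree E v"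
      then have light: "degree E u + degree E v < card (L {u, v}) + 2"
        using L[OF uv] m[of u] m[of v] by linarith
      have "E - {{u, v}} \<subset> E" using uv by blast
      then obtain c where c: "proper_from (E - {{u, v}}) L c" using smaller by blast
      then show False using extend_light_edge[OF G uv c light] no by blast
    qed
    define good where "good = (\<lambda>k \<sigma>. (\<forall>a\<in>{v\<in>\<Union>E. degree E v \<le> Suc k}. \<sigma> a \<in> nbrs E a) \<and>
        (\<forall>b. card {a\<in>{v\<in>\<Union>E. degree E v \<le> Suc k}. \<sigma> a = b} \<le> k))"
    have "\<exists>\<sigma>. good k \<sigma>" if k: "k < 5" for k
    proof -
      have "finite {v\<in>\<Union>E. degree E v \<le> Suc k}" by (rule finite_subset[OF _ finU]) auto
      from assignment_or_saturated[OF this, of "nbrs E" k] show ?thesis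
      proof (elim disjE exE conjE)
        fix R \<sigma> assume R: "R \<noteq> {}" "R \<subseteq> {v\<in>\<Union>E. degree E v \<le> Suc k}"
          and sat: "\<forall>b\<in>\<Union>(nbrs E ` R). k \<le> card {a\<in>R. b \<in> nbrs E a \<and> \<sigma> a = b}"
        have "\<exists>c. proper_from E L c"
        proof (rule extend_saturated[OF G _ R(1), of k \<sigma>])
          show "R \<subseteq> \<Union>E" "\<And>a. a \<in> R \<Longrightarrow> degree E a \<le> Suc k" using R(2) by auto
          fix a b assume ab: "a \<in> R" "{a, b} \<in> E"
          have "degree E a \<le> 5" using ab R(2) k by auto
          then show "degree E b > 5" using heavy[OF ab(2)] N by linarith
          have "b \<in> \<Union>(nbrs E ` R)" using ab unfolding nbrs_def by blast
          from sat[rule_format, OF this] show "k \<le> card {a\<in>R. {a, b} \<in> E \<and> \<sigma> a = b}"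
            unfolding nbrs_def by simp
          \<comment> \<open>The spare 1 in the degree bound pays for \<open>m a\<close>.\<close>
          show "degree E b \<le> card (L {a, b})" using L[OF ab(2)] deg[of b] m[of a] by linarith
        qed (use k smaller in auto)
        then show ?thesis using no by blast
      next
        fix \<sigma> assume "\<forall>a\<in>{v\<in>\<Union>E. degree E v \<le> Suc k}. \<sigma> a \<in> nbrs E a"
          "\<forall>b. card {a\<in>{v\<in>\<Union>E. degree E v \<le> Suc k}. \<sigma> a = b} \<le> k"
        then show ?thesis unfolding good_def by (intro exI[of _ \<sigma>] conjI)
      qed
    qed
    then obtain \<sigma> where \<sigma>: "\<And>k. k < 5 \<Longrightarrow> good k (\<sigma> k)" by metis
    have "3 * card (\<Union>E) \<le> card E"
    proof (rule assignments_imp_dense[OF G, of \<sigma>])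
      fix k v assume kv: "k < 5" "v \<in> \<Union>E" "degree E v \<le> Suc k"
      then have e: "{v, \<sigma> k v} \<in> E" using \<sigma>[OF kv(1)] unfolding good_def nbrs_def by blast
      then show "\<sigma> k v \<in> \<Union>E \<and> degree E (\<sigma> k v) \<ge> 16"
        using heavy[OF e] kv(1,3) N by auto
    next
      fix k b assume k: "(k::nat) < 5"
      have "{v\<in>\<Union>E. degree E v \<le> Suc k \<and> \<sigma> k v = b} = {a\<in>{v\<in>\<Union>E. degree E v \<le> Suc k}. \<sigma> k a = b}"
        by blast
      then show "card {v\<in>\<Union>E. degree E v \<le> Suc k \<and> \<sigma> k v = b} \<le> k"
        using \<sigma>[OF k] unfolding good_def by simp
    qed
    \<comment> \<open>The empty edge set is coloured trivially, so sparsity applies to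
      \<open>E\<close>.\<close>
    moreover have "E \<noteq> {}" using no unfolding proper_from_def by auto
    ultimately show False using sparse[of E] by simp
  qed
qed

section \<open>Extending total precolourings\<close>

text \<open>Taking \<open>\<Union>D\<close> as vertex set discards isolated vertices. Two covered
  vertices carry a single edge and lie outside the range of
  \<open>drawable_edge_bound\<close>.\<close>

lemma drawable_sparse:
  assumes G: "simple_graph V E" "drawable V E" and D: "D \<subseteq> E" "D \<noteq> {}"
  shows "card D < 3 * card (\<Union>D)"
proof -
  have sub: "\<Union>D \<subseteq> V" using G(1) D unfolding simple_graph_def by blast
  have finU: "finite (\<Union>D)" using sub G(1) finite_subset unfolding simple_graph_def by auto
  have GD: "simple_graph (\<Union>D) D"
    using G(1) D finU unfolding simple_graph_def by blast
  have DD: "drawable (\<Union>D) D" using drawable_mono[OF G(2) sub D(1)] .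
  obtain e where e: "e \<in> D" using D(2) by blast
  then have "card e = 2" "e \<subseteq> \<Union>D" using GD unfolding simple_graph_def by auto
  then have U2: "2 \<le> card (\<Union>D)" using card_mono[OF finU] by metis
  show ?thesis
  proof (cases "card (\<Union>D) = 2")
    case True
    have "f = \<Union>D" if "f \<in> D" for f
      using that True finU GD unfolding simple_graph_def by (intro card_subset_eq) auto
    then have "D \<subseteq> {\<Union>D}" by blast
    then have "card D \<le> card {\<Union>D}" by (intro card_mono) auto
    then show ?thesis using True by simp
  next
    case False
    then show ?thesis using drawable_edge_bound[OF GD DD] U2 by linarith
  qed
qed

text \<open>Greedy: a new vertex sees at most \<open>degree E v < k\<close> colours.\<close>

lemma extend_vertex_colouring:
  fixes cv :: "'a \<Rightarrow> nat"
  assumes G: "simple_graph V E" and "VH \<subseteq> V" and deg: "\<And>v. v \<in> V \<Longrightarrow> degree E v < k"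
    and cv: "\<And>v. v \<in> VH \<Longrightarrow> cv v \<in> {1..k}"
      "\<And>u v. u \<in> VH \<Longrightarrow> v \<in> VH \<Longrightarrow> {u, v} \<in> E \<Longrightarrow> cv u \<noteq> cv v"
  shows "\<exists>c. (\<forall>v\<in>VH. c v = cv v) \<and> (\<forall>v\<in>V. c v \<in> {1..k}) \<and> (\<forall>u\<in>V. \<forall>v\<in>V. {u, v} \<in> E \<longrightarrow> c u \<noteq> c v)"
proof -
  have "\<exists>c. (\<forall>v\<in>VH. c v = cv v) \<and> (\<forall>v\<in>VH \<union> W. c v \<in> {1..k}) \<and>
      (\<forall>u\<in>VH \<union> W. \<forall>v\<in>VH \<union> W. {u, v} \<in> E \<longrightarrow> c u \<noteq> c v)"
    if "finite W" "W \<subseteq> V" for W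
    using that
  proof (induction W rule: finite_induct)
    case empty
    show ?case using cv by (intro exI[of _ cv]) simp
  next
    case (insert w W)
    then obtain c where c: "\<forall>v\<in>VH. c v = cv v" "\<forall>v\<in>VH \<union> W. c v \<in> {1..k}"
      "\<forall>u\<in>VH \<union> W. \<forall>v\<in>VH \<union> W. {u, v} \<in> E \<longrightarrow> c u \<noteq> c v"
      by auto
    show ?case
    proof (cases "w \<in> VH")
      case True
      then have "VH \<union> insert w W = VH \<union> W" by blast
      then show ?thesis using c by metis
    next
      case False
      have "card (c ` nbrs E w) \<le> card (nbrs E w)"
        by (rule card_image_le[OF finite_nbrs[OF G]])
      also have "\<dots> < card {1..k}"
        using deg[of w] insert.prems degree_eq_card_nbrs[OF G, of w] by simp
      finally have "\<not> {1..k} \<subseteq> c ` nbrs E w"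
        using card_mono[OF finite_imageI[OF finite_nbrs[OF G, of w]], of "{1..k}" c] by linarith
      then obtain x where x: "x \<in> {1..k}" "x \<notin> c ` nbrs E w" by blast
      have xn: "x \<noteq> c v" if "{w, v} \<in> E" for v using x(2) that unfolding nbrs_def by blast
      have loop: "{w, w} \<notin> E" using simple_graph_edgeD[OF G, of w w] by blast
      show ?thesis
      proof (intro exI[of _ "c(w := x)"] conjI ballI impI)
        show "(c(w := x)) v = cv v" if "v \<in> VH" for v using that False c(1) by auto
        show "(c(w := x)) v \<in> {1..k}" if "v \<in> VH \<union> insert w W" for v using that c(2) x(1) by auto
        fix u v assume uv: "u \<in> VH \<union> insert w W" "v \<in> VH \<union> insert w W" "{u, v} \<in> E"
        consider "u = w" "v = w" | "u = w" "v \<noteq> w" | "u \<noteq> w" "v = w" | "u \<noteq> w" "v \<noteq> w" by blast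
        then show "(c(w := x)) u \<noteq> (c(w := x)) v"
        proof cases
          case 1
          then show ?thesis using loop uv by simp
        next
          case 2
          then show ?thesis using xn[of v] uv by simp
        next
          case 3
          then show ?thesis using xn[of u] uv by (auto simp: insert_commute)
        next
          case 4
          then show ?thesis using c(3) uv by simp
        qed
      qed
    qed
  qed
  from this[of V] show ?thesis
    using G assms(2) unfolding simple_graph_def by (simp add: Un_absorb1)
qed

lemma degree_le_max_degree:
  assumes "finite V" "v \<in> V"
  shows "degree E v \<le> max_degree V E"
  using assms unfolding max_degree_def by (intro Max_ge) auto

theorem theorem5p1:
  fixes V VH :: "'a set" and E EH :: "'a set set" and t :: nat
    and cv :: "'a \<Rightarrow> nat" and ce :: "'a set \<Rightarrow> nat"
  assumes "3 \<le> t" and "t \<le> 6"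
    and "simple_graph V E" and "planar V E"
    and "max_degree V E \<ge> 31 - t"
    and "subgraph VH EH V E" and "max_degree VH EH \<le> 1"
    and "total_coloring_in VH EH V E (max_degree V E + t) cv ce"
  shows "\<exists>cv' ce'. total_coloring V E (max_degree V E + t) cv' ce' \<and>
           (\<forall>v\<in>VH. cv' v = cv v) \<and> (\<forall>e\<in>EH. ce' e = ce e)"
proof -
  note G = \<open>simple_graph V E\<close>
  let ?k = "max_degree V E + t"
  have finV: "finite V" using G unfolding simple_graph_def by simp
  have fin: "finite E" using simple_graph_finite[OF G] .
  have H: "VH \<subseteq> V" "EH \<subseteq> E" "\<And>e. e \<in> EH \<Longrightarrow> e \<subseteq> VH"
    using assms(6) unfolding subgraph_def by auto
  have finEH: "finite EH" by (rule finite_subset[OF H(2) fin])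
  note H_col = assms(8)[unfolded total_coloring_in_def]
  note pre = H_col[THEN conjunct1, rule_format]
    H_col[THEN conjunct2, THEN conjunct1, rule_format]
    H_col[THEN conjunct2, THEN conjunct2, THEN conjunct1, rule_format]
    H_col[THEN conjunct2, THEN conjunct2, THEN conjunct2, THEN conjunct1, rule_format]
    H_col[THEN conjunct2, THEN conjunct2, THEN conjunct2, THEN conjunct2, rule_format]
  have degE: "degree E v \<le> max_degree V E" for v
  proof (cases "v \<in> V")
    case False
    then have "{e\<in>E. v \<in> e} = {}" using G unfolding simple_graph_def by blast
    then show ?thesis unfolding degree_def by (simp only: card.empty le0)
  qed (use degree_le_max_degree[OF finV] in blast)
  have degEH: "degree EH v \<le> 1" for v
  proof (cases "v \<in> VH")
    case True
    then have "degree EH v \<le> max_degree VH EH"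
      by (rule degree_le_max_degree[OF finite_subset[OF H(1) finV]])
    then show ?thesis using assms(7) by linarith
  next
    case False
    then have "{e\<in>EH. v \<in> e} = {}" using H(3) by blast
    then show ?thesis unfolding degree_def by (simp only: card.empty le0)
  qed
  have "degree E v < ?k" for v using degE[of v] assms(1) by linarith
  then have "\<exists>c. (\<forall>v\<in>VH. c v = cv v) \<and> (\<forall>v\<in>V. c v \<in> {1..?k}) \<and>
      (\<forall>u\<in>V. \<forall>v\<in>V. {u, v} \<in> E \<longrightarrow> c u \<noteq> c v)"
    by (rule extend_vertex_colouring[OF G H(1) _ pre(1,3)])
  then obtain c where c: "\<And>v. v \<in> VH \<Longrightarrow> c v = cv v" "\<And>v. v \<in> V \<Longrightarrow> c v \<in> {1..?k}"
    "\<And>u v. u \<in> V \<Longrightarrow> v \<in> V \<Longrightarrow> {u, v} \<in> E \<Longrightarrow> c u \<noteq> c v"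
    by (elim exE conjE) blast
  define L where "L = (\<lambda>e. {1..?k} - c ` e - ce ` {f\<in>EH. f \<inter> e \<noteq> {}})"
  have "\<exists>d. proper_from (E - EH) L d"
  \<comment> \<open>The two ends of an edge and the precoloured edges at them cost at most
    \<open>2 + m u + m v\<close> colours, hence \<open>N = ?k - 2\<close>.\<close>
  proof (rule list_edge_colourable[where N = "?k - 2" and m = "degree EH"])
    show "simple_graph V (E - EH)" by (rule simple_graph_mono[OF G]) blast
    show "21 \<le> ?k - 2" using assms(5) by linarith
    show "degree EH v \<le> 1" for v by (rule degEH)
    \<comment> \<open>The two degrees add up to \<open>degree E v\<close>, at most
      \<open>?k - t\<close>; with \<open>t \<ge> 3\<close> one more still fits into
      \<open>?k - 2\<close>.\<close>
    show "degree (E - EH) v + degree EH v + 1 \<le> ?k - 2" for v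
    proof -
      have "card ({e\<in>E - EH. v \<in> e} \<union> {e\<in>EH. v \<in> e}) = degree (E - EH) v + degree EH v"
        unfolding degree_def using fin finEH by (intro card_Un_disjoint) auto
      moreover have "{e\<in>E - EH. v \<in> e} \<union> {e\<in>EH. v \<in> e} = {e\<in>E. v \<in> e}" using H(2) by blast
      ultimately show ?thesis using degE[of v] assms(1) unfolding degree_def by simp
    qed
    show "card D < 3 * card (\<Union>D)" if "D \<subseteq> E - EH" "D \<noteq> {}" for D
      using drawable_sparse[OF G planar_imp_drawable[OF G assms(4)]] that by blast
    show "?k - 2 \<le> card (L {u, v}) + degree EH u + degree EH v" for u v
    proof -
      have "card (c ` {u, v}) \<le> 2"
        using card_image_le[of "{u, v}" c] card_insert_le_m1[of 2 "{v}" u] by simp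
      then have "?k - 2 \<le> card ({1..?k} - c ` {u, v})"
        using diff_card_le_card_Diff[of "c ` {u, v}" "{1..?k}"] by simp
      moreover have "card ({1..?k} - c ` {u, v}) \<le> card (L {u, v}) + card {f\<in>EH. f \<inter> {u, v} \<noteq> {}}"
        unfolding L_def using card_residual[OF finEH, of "\<lambda>e. {1..?k} - c ` e" "{u, v}" ce] .
      moreover have "card {f\<in>EH. f \<inter> {u, v} \<noteq> {}} \<le> card ({f\<in>EH. u \<in> f} \<union> {f\<in>EH. v \<in> f})"
        using finEH by (intro card_mono) auto
      moreover have "\<dots> \<le> degree EH u + degree EH v"
        unfolding degree_def by (rule card_Un_le)
      ultimately show ?thesis by linarith
    qed
  qed
  then obtain d where d: "proper_from (E - EH) L d" by blast
  have pEH: "proper_from EH (\<lambda>e. {1..?k} - c ` e) ce"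
    unfolding proper_from_def
  proof (intro conjI ballI impI)
    fix e assume e: "e \<in> EH"
    \<comment> \<open>\<open>c\<close> agrees with \<open>cv\<close> on \<open>VH\<close>, which
      contains both ends of \<open>e\<close>, so the precoloured edges respect \<open>c\<close> as
      well.\<close>
    then have "ce e \<noteq> c v" if "v \<in> e" for v using that pre(5)[OF e that] c(1)[of v] H(3)[OF e] by auto
    then show "ce e \<in> {1..?k} - c ` e" using pre(2)[OF e] by auto
  qed (use pre(4) in blast)
  define ce' where "ce' = (\<lambda>e. if e \<in> E - EH then d e else ce e)"
  have p: "proper_from E (\<lambda>e. {1..?k} - c ` e) ce'"
  proof -
    have "EH \<union> (E - EH) = E" using H(2) by blast
    then show ?thesis
      using proper_from_extend[OF pEH d[unfolded L_def]] unfolding ce'_def by simp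
  qed
  have "total_coloring V E ?k c ce'"
    unfolding total_coloring_def total_coloring_in_def
  proof (intro conjI)
    show "\<forall>v\<in>V. c v \<in> {1..?k}" "\<forall>u\<in>V. \<forall>v\<in>V. {u, v} \<in> E \<longrightarrow> c u \<noteq> c v"
      using c(2,3) by simp_all
    show "\<forall>e\<in>E. \<forall>f\<in>E. e \<noteq> f \<and> e \<inter> f \<noteq> {} \<longrightarrow> ce' e \<noteq> ce' f"
      using p unfolding proper_from_def by (rule conjunct2)
    have col: "ce' e \<in> {1..?k} - c ` e" if "e \<in> E" for e
      using p that unfolding proper_from_def by simp
    then show "\<forall>e\<in>E. ce' e \<in> {1..?k}" by (meson DiffD1)
    show "\<forall>e\<in>E. \<forall>v\<in>e. ce' e \<noteq> c v"
      using col by (metis DiffD2 imageI)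
  qed
  moreover have "\<forall>e\<in>EH. ce' e = ce e" unfolding ce'_def by auto
  ultimately show ?thesis using c(1) by blast
qed

end
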